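(* Let $d\ge1$, let $\lambda=(\lambda_1,\dots,\lambda_d)$ with $\lambda_i>-\frac12$ for all $i$, let $\mu$ be the measure on $[-1,1]^d$ with density $\prod_{j=1}^d(1-x_j^2)^{\lambda_j-\frac12}$ with respect to Lebesgue measure (the orthogonality measure of the multiple Gegenbauer polynomials on the cube), and let $(\Omega_n)_n$, $(\alpha_{\cdot|n})_n$ be its Jacobi sequences. For all $n\in\mathbb{N}$ and $\overline{i}_n=cl\big((i_1,\dots,i_n)\big)$, $\overline{j}_n=cl\big((j_1,\dots,j_n)\big)\in\mathcal{A}_n$, put $n_l=\sharp\{k\in\{1,\dots,n\}: i_k=l\}$ for $1\le l\le d$, $\overline{n}=(n_1,\dots,n_d)$ and $\overline n!=n_1!\cdots n_d!$. Then $\alpha_{\cdot|n}\equiv0$, and the coefficients $\lambda_{\overline{i}_n,\overline{j}_n}$ of $\Omega_n$ in the basis $(e_{\overline{i}_n})_{\overline{i}_n\in\mathcal{A}_n}$ of $(\mathbb{C}^d)^{\hat\otimes n}$ are given by $$\lambda_{\overline{i}_n,\overline{j}_n}=\delta_{\overline{i}_n,\overline{j}_n}\frac{2^{2|\lambda|}}{\overline{n}!}\prod_{i=1}^d\Big(\prod_{p=0}^{n_i-1}\frac{(p+1)(2\lambda_i+p)}{(p+\lambda_i)(2p+2\lambda_i+1)}\Big)^2\prod_{j=1}^d\frac{\big[\Gamma(n_j+\lambda_j+\frac12)\big]^2}{(2n_j+2\lambda_j)\Gamma(n_j+2\lambda_j)},$$ where $|\lambda|=\lambda_1+\cdots+\lambda_d$,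 with the convention that the product $\prod_{p=0}^{-1}$ (used when $n_i=0$) equals $1$.
   Context: $\mathbb{N}=\{0,1,2,\dots\}$. Let $\mathcal{P}=\mathbb{C}[X_1,\dots,X_d]$, and let $\mathcal{P}_{n]}$ be the polynomials of degree at most $n$, $\mathcal{P}_{-1]}=\{0\}$. Let $\langle P,Q\rangle_\mu=\int\overline{P}\,Q\,d\mu$. Let $\mathcal{P}_n$ be the $\langle\cdot,\cdot\rangle_\mu$-orthogonal complement of $\mathcal{P}_{n-1]}$ in $\mathcal{P}_{n]}$, and $P_n:\mathcal{P}\to\mathcal{P}_n$ the orthogonal projection. For $v=(v_1,\dots,v_d)\in\mathbb{C}^d$ let $X_v=\sum_j v_jX_j$ (multiplication operator), $a^+_v=\sum_n P_{n+1}X_vP_n$ on $\mathcal{P}$, and $a^0_{v|n}=P_nX_vP_n|_{\mathcal{P}_n}:\mathcal{P}_n\to\mathcal{P}_n$. $(\mathbb{C}^d)^{\hat\otimes n}$ is the space of symmetric tensors of order $n$, $v_n\hat\otimes\cdots\hat\otimes v_1$ is the symmetrization of $v_n\otimes\cdots\otimes v_1$, and the tensor scalar product satisfies $\langle u^{\otimes n},v^{\otimes n}\rangle=\langle u,v\rangle_{\mathbb{C}^d}^n$ with the standard scalar product on $\mathbb{C}^d$. The linear isomorphism $U_n:(\mathbb{C}^d)^{\hat\otimes n}\to\mathcal{P}_n$ is given by $U_n(v_n\hat\otimes\cdots\hat\otimes v_1)=a^+_{v_n}\cdots a^+_{v_1}1$, $U_0(z)=z\cdot1$. The Jacobi sequences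 are: $\Omega_n$, the linear operator on $(\mathbb{C}^d)^{\hat\otimes n}$ with $\langle\xi,\Omega_n\eta\rangle_{(\mathbb{C}^d)^{\hat\otimes n}}=\langle U_n\xi,U_n\eta\rangle_\mu$; and $\alpha_{v|n}=U_n^{-1}a^0_{v|n}U_n$, $v\in\mathbb{C}^d$. Let $(e_1,\dots,e_d)$ be the canonical basis of $\mathbb{C}^d$. Two tuples in $\{1,\dots,d\}^n$ are equivalent if every $l\in\{1,\dots,d\}$ occurs the same number of times in both; $cl(\cdot)$ denotes the equivalence class and $\mathcal{A}_n$ the set of classes. For $\overline{j}_n=cl((j_1,\dots,j_n))$ put $e_{\overline{j}_n}=e_{j_1}\hat\otimes\cdots\hat\otimes e_{j_n}$. The coefficients of $\Omega_n$ in this basis mean $\lambda_{\overline{i}_n,\overline{j}_n}=\langle e_{\overline{i}_n},\Omega_n e_{\overline{j}_n}\rangle_{(\mathbb{C}^d)^{\hat\otimes n}}$ (doubly indexed, not to be confused with the parameters $\lambda_i$). $\delta$ is the Kronecker symbol and $\Gamma(y)=\int_0^\infty t^{y-1}e^{-t}\,dt$, $y>0$, is the Gamma function.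
   Formalization: When some λ_i = 0 the printed formula contains 0/0 (factor p = 0) or 0·Γ(0) (when n_i = 0); these factors are read as their limits as λ_i → 0. For n_j = 0 and -1/2 < λ_j < 0, Γ(2λ_j) is the analytic continuation of the Gamma integral. *)

theory Defs
  imports
    "HOL-Analysis.Analysis"
    "HOL-Library.Poly_Mapping"
    "HOL-Library.Function_Algebras"
    "HOL-Library.FuncSet"
    "HOL-Combinatorics.Combinatorics"
begin

section \<open>Complex polynomials in finitely many variables\<close>

text \<open>
  The variables \<open>X\<^sub>j\<close> are indexed by a finite (nonempty) type \<open>'d\<close>, so that \<open>d = CARD('d)\<close> is an
  arbitrary positive integer. A monomial is its exponent vector, and the ring structure is the
  monoid-algebra structure of \<^theory>\<open>HOL-Library.Poly_Mapping\<close>.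
\<close>

type_synonym 'd cpoly = "('d \<Rightarrow>\<^sub>0 nat) \<Rightarrow>\<^sub>0 complex"

definition poly_scale :: "complex \<Rightarrow> ('d::finite) cpoly \<Rightarrow> 'd cpoly" where
  "poly_scale c p = Poly_Mapping.single 0 c * p"

definition peval :: "('d::finite) cpoly \<Rightarrow> real ^ 'd \<Rightarrow> complex" where
  "peval p x =
     (\<Sum>m\<in>Poly_Mapping.keys p.
        Poly_Mapping.lookup p m * (\<Prod>i\<in>UNIV. complex_of_real (x $ i) ^ Poly_Mapping.lookup m i))"

text \<open>The space of polynomials of total degree at most \<open>n\<close>; for \<open>n = -1\<close> it is \<open>{0}\<close>.\<close>

definition polys_le :: "int \<Rightarrow> ('d::finite) cpoly set" where
  "polys_le n =
     {p. \<forall>m\<in>Poly_Mapping.keys p. int (\<Sum>i\<in>UNIV. Poly_Mapping.lookup m i) \<le> n}"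

definition mulX :: "complex ^ ('d::finite) \<Rightarrow> 'd cpoly \<Rightarrow> 'd cpoly" where
  "mulX v p =
     (\<Sum>j\<in>UNIV. poly_scale (v $ j) (Poly_Mapping.single (Poly_Mapping.single j 1) 1)) * p"


section \<open>Orthogonal gradation and creation operators\<close>

definition pip :: "(real ^ 'd::finite) measure \<Rightarrow> 'd cpoly \<Rightarrow> 'd cpoly \<Rightarrow> complex" where
  "pip \<mu> p q = (LINT x|\<mu>. cnj (peval p x) * peval q x)"

definition orth_polys :: "(real ^ 'd::finite) measure \<Rightarrow> nat \<Rightarrow> 'd cpoly set" where
  "orth_polys \<mu> n = {p \<in> polys_le (int n). \<forall>q\<in>polys_le (int n - 1). pip \<mu> q p = 0}"

definition proj :: "(real ^ 'd::finite) measure \<Rightarrow> nat \<Rightarrow> 'd cpoly \<Rightarrow> 'd cpoly" where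
  "proj \<mu> n p = (THE r. r \<in> orth_polys \<mu> n \<and> (\<forall>s\<in>orth_polys \<mu> n. pip \<mu> s (p - r) = 0))"

text \<open>
  On each polynomial only finitely many summands of the creation operator are nonzero;
  \<open>Sum_any\<close> is the sum over the nonzero terms.
\<close>

definition creation ::
    "(real ^ 'd::finite) measure \<Rightarrow> complex ^ 'd \<Rightarrow> 'd cpoly \<Rightarrow> 'd cpoly" where
  "creation \<mu> v p = Sum_any (\<lambda>n. proj \<mu> (n + 1) (mulX v (proj \<mu> n p)))"

definition preservation ::
    "(real ^ 'd::finite) measure \<Rightarrow> complex ^ 'd \<Rightarrow> nat \<Rightarrow> 'd cpoly \<Rightarrow> 'd cpoly" where
  "preservation \<mu> v n = restrict (\<lambda>p. proj \<mu> n (mulX v (proj \<mu> n p))) (orth_polys \<mu> n)"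


section \<open>Symmetric tensors\<close>

text \<open>
  A tensor of order \<open>n\<close> over \<open>\<complex>\<^sup>d\<close> is given by its coordinates in the basis
  \<open>e(i\<^sub>1) \<otimes> \<dots> \<otimes> e(i\<^sub>n)\<close>, that is, by a function on index lists which vanishes off the lists of
  length \<open>n\<close>. The vector space operations are the pointwise ones.
\<close>

type_synonym 'd tensor = "'d list \<Rightarrow> complex"

definition tensor_scale :: "complex \<Rightarrow> 'd tensor \<Rightarrow> 'd tensor" where
  "tensor_scale c T = (\<lambda>i. c * T i)"

definition sym_tensors :: "nat \<Rightarrow> ('d::finite) tensor set" where
  "sym_tensors n =
     {T. (\<forall>i. length i \<noteq> n \<longrightarrow> T i = 0) \<and>
         (\<forall>\<sigma> i. \<sigma> permutes {..<n} \<and> length i = n \<longrightarrow> T (permute_list \<sigma> i) = T i)}"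

definition tensor_ip :: "nat \<Rightarrow> ('d::finite) tensor \<Rightarrow> 'd tensor \<Rightarrow> complex" where
  "tensor_ip n S T = (\<Sum>i | length i = n. cnj (S i) * T i)"

definition tensor_prod :: "(complex ^ 'd::finite) list \<Rightarrow> 'd tensor" where
  "tensor_prod vs =
     (\<lambda>i. if length i = length vs then \<Prod>k<length vs. (vs ! k) $ (i ! k) else 0)"

text \<open>
  With the averaging factor \<open>1/n!\<close> the symmetrized product of \<open>n\<close> copies of \<open>u\<close> is the \<open>n\<close>-th
  tensor power of \<open>u\<close>.
\<close>

definition sym_prod :: "(complex ^ 'd::finite) list \<Rightarrow> 'd tensor" where
  "sym_prod vs =
     (\<lambda>i. (\<Sum>\<sigma> | \<sigma> permutes {..<length vs}. tensor_prod (permute_list \<sigma> vs) i) / fact (length vs))"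


section \<open>Jacobi sequences of a measure\<close>

definition linear_on ::
    "(complex \<Rightarrow> 'a \<Rightarrow> 'a) \<Rightarrow> (complex \<Rightarrow> 'b \<Rightarrow> 'b) \<Rightarrow> ('a::plus) set \<Rightarrow> ('a \<Rightarrow> 'b::plus) \<Rightarrow> bool" where
  "linear_on sa sb S f \<longleftrightarrow>
     (\<forall>x\<in>S. \<forall>y\<in>S. f (x + y) = f x + f y) \<and> (\<forall>c. \<forall>x\<in>S. f (sa c x) = sb c (f x))"

text \<open>
  Operators whose domain is the space of symmetric tensors are taken to be \<^const>\<open>extensional\<close> on it,
  which makes the descriptions below unique. The list \<open>[v\<^sub>n, \<dots>, v\<^sub>1]\<close> stands for the product
  \<open>v\<^sub>n \<otimes> \<dots> \<otimes> v\<^sub>1\<close>; for \<open>n = 0\<close> the empty product is the scalar 1.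
\<close>

definition U_map :: "(real ^ 'd::finite) measure \<Rightarrow> nat \<Rightarrow> 'd tensor \<Rightarrow> 'd cpoly" where
  "U_map \<mu> n =
     (THE U. U \<in> extensional (sym_tensors n) \<and>
        linear_on tensor_scale poly_scale (sym_tensors n) U \<and>
        bij_betw U (sym_tensors n) (orth_polys \<mu> n) \<and>
        (\<forall>vs. length vs = n \<longrightarrow> U (sym_prod vs) = foldr (creation \<mu>) vs 1))"

definition Jacobi_Omega :: "(real ^ 'd::finite) measure \<Rightarrow> nat \<Rightarrow> 'd tensor \<Rightarrow> 'd tensor" where
  "Jacobi_Omega \<mu> n =
     (THE W. W \<in> sym_tensors n \<rightarrow>\<^sub>E sym_tensors n \<and>
        linear_on tensor_scale tensor_scale (sym_tensors n) W \<and>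
        (\<forall>\<xi>\<in>sym_tensors n. \<forall>\<eta>\<in>sym_tensors n.
           tensor_ip n \<xi> (W \<eta>) = pip \<mu> (U_map \<mu> n \<xi>) (U_map \<mu> n \<eta>)))"

definition Jacobi_alpha ::
    "(real ^ 'd::finite) measure \<Rightarrow> complex ^ 'd \<Rightarrow> nat \<Rightarrow> 'd tensor \<Rightarrow> 'd tensor" where
  "Jacobi_alpha \<mu> v n =
     restrict (\<lambda>T. inv_into (sym_tensors n) (U_map \<mu> n) (preservation \<mu> v n (U_map \<mu> n T)))
       (sym_tensors n)"


section \<open>Coefficients in the basis of symmetrized basis tensors\<close>

definition tuple_rel :: "nat \<Rightarrow> ('d::finite list \<times> 'd list) set" where
  "tuple_rel n =
     {(i, j). length i = n \<and> length j = n \<and> (\<forall>l. count_list i l = count_list j l)}"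

definition tuple_class :: "nat \<Rightarrow> 'd::finite list \<Rightarrow> 'd list set" where
  "tuple_class n i = tuple_rel n `` {i}"

definition e_class :: "nat \<Rightarrow> 'd::finite list set \<Rightarrow> 'd tensor" where
  "e_class n J =
     (THE T. \<exists>j. length j = n \<and> J = tuple_class n j \<and> T = sym_prod (map (\<lambda>k. axis k 1) j))"

definition Omega_coeff ::
    "(real ^ 'd::finite) measure \<Rightarrow> nat \<Rightarrow> 'd list set \<Rightarrow> 'd list set \<Rightarrow> complex" where
  "Omega_coeff \<mu> n I J = tensor_ip n (e_class n I) (Jacobi_Omega \<mu> n (e_class n J))"


section \<open>The multiple Gegenbauer weight on the cube\<close>

definition gegenbauer_measure :: "real ^ 'd::finite \<Rightarrow> (real ^ 'd) measure" where
  "gegenbauer_measure lam =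
     density lborel
       (\<lambda>x. ennreal (indicator {x. \<forall>j. x $ j \<in> {-1..1}} x *
                     (\<Prod>j\<in>UNIV. (1 - (x $ j)\<^sup>2) powr (lam $ j - 1/2))))"

text \<open>
  Two factors of the coefficient formula are undefined when a parameter is 0: the factor \<open>p = 0\<close> of
  the inner product (\<open>0/0\<close>) and, for \<open>n\<^sub>j = 0\<close>, the denominator (zero times a pole of \<open>\<Gamma>\<close>). Both
  singularities are removable and the factors are read as their continuous extensions, since
  division by zero and \<open>Gamma\<close> at its poles have the value 0 in HOL. For \<open>n\<^sub>j = 0\<close> and a parameter
  in \<open>(-1/2, 0)\<close> the argument of \<open>\<Gamma>\<close> in the denominator lies in \<open>(-1, 0)\<close>, where
  \<^const>\<open>Gamma\<close> is the analytic continuation of the Euler integral.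
\<close>

definition ext0 :: "(real \<Rightarrow> real) \<Rightarrow> real \<Rightarrow> real" where
  "ext0 f t = (if t = 0 then Lim (at 0) f else f t)"

end

theory Submission
  imports Defs
begin

text \<open>
  The weight on the cube is a product of the weights \<open>(1 - x\<^sup>2) powr (l - 1/2)\<close> of the Gegenbauer
  polynomials, one for each coordinate. Products of the monic Gegenbauer polynomials in the single
  variables, \<open>Q m\<close> for an exponent vector \<open>m\<close>, therefore form an orthogonal basis of the polynomials.
  Multiplication by a variable \<open>X\<^sub>j\<close> acts on this basis by the univariate three-term recurrence in the
  \<open>j\<close>-th index: it raises this index with coefficient one and lowers it with some coefficient, and it
  has no diagonal part since the weight is even.

  This determines the Jacobi sequences for every measure with such a basis (locale
  \<open>orthogonal_family\<close>). The \<open>n\<close>-th component of the gradation is spanned by the \<open>Q m\<close> of total degree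
  \<open>n\<close>. The preservation operators vanish because there is no diagonal part, hence so does \<open>\<alpha>\<close>. The
  creation operators only see the raising part, so creating along the index list \<open>i\<close> from \<open>1\<close> gives
  \<open>Q\<close> at the exponent vector that counts the indices of \<open>i\<close>. Consequently \<open>U\<^sub>n\<close> sends the symmetrized
  basis tensors to the members of the family, and the coefficients of \<open>\<Omega>\<^sub>n\<close> are the inner products
  of these: zero for different classes and the squared norm of \<open>Q m\<close> on the diagonal
  (\<open>Omega_coeff_eq\<close>).

  What remains is the analysis on the interval. A first-order structure relation for the polynomials
  defined by the recurrence and one integration by parts show that all but the zeroth have integral
  zero; orthogonality follows from the recurrence, with the squared norm being the total mass times a
  product of recurrence coefficients (\<open>gegenbauer_orthogonality\<close>). The total mass is a Beta integral,
  and comparing quotients of consecutive terms identifies the norm with the stated expression, where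
  the continuous extensions take care of the parameter value zero (\<open>gegenbauer_norm_closed_form\<close>).
\<close>


section \<open>Polynomials as functions and exponent vectors\<close>

definition mdeg :: "('d::finite \<Rightarrow>\<^sub>0 nat) \<Rightarrow> nat" where
  "mdeg m = (\<Sum>i\<in>UNIV. Poly_Mapping.lookup m i)"

lemma polys_le_iff_mdeg: "p \<in> polys_le n \<longleftrightarrow> (\<forall>m\<in>Poly_Mapping.keys p. int (mdeg m) \<le> n)"
  by (simp add: polys_le_def mdeg_def)

definition unit_exp :: "'d::finite \<Rightarrow> ('d \<Rightarrow>\<^sub>0 nat)" where
  "unit_exp j = Poly_Mapping.single j 1"

definition var :: "'d::finite \<Rightarrow> 'd cpoly" where
  "var j = Poly_Mapping.single (unit_exp j) 1"

interpretation cpoly: vector_space "poly_scale :: complex \<Rightarrow> ('d::finite) cpoly \<Rightarrow> 'd cpoly"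
  by unfold_locales
    (simp_all add: poly_scale_def algebra_simps single_add mult_single flip: mult.assoc)

lemma poly_scale_mult_left: "poly_scale c p * q = poly_scale c (p * q)"
  by (simp add: poly_scale_def mult.assoc)

lemma poly_scale_mult_right: "p * poly_scale c q = poly_scale c (p * q)"
  by (simp add: poly_scale_def mult_ac)

lemma poly_scale_single: "poly_scale c (Poly_Mapping.single m a) = Poly_Mapping.single m (c * a)"
  by (simp add: poly_scale_def mult_single)

lemma lookup_poly_scale: "Poly_Mapping.lookup (poly_scale c p) m = c * Poly_Mapping.lookup p m"
  by (simp add: poly_scale_def flip: mult_map_scale_conv_mult) (simp add: map.rep_eq when_def)

lemma sum_monomials:
  "p = (\<Sum>m\<in>Poly_Mapping.keys p. Poly_Mapping.single m (Poly_Mapping.lookup p m))"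
  by (rule poly_mapping_eqI)
    (simp add: lookup_sum lookup_single when_def in_keys_iff)

lemma cpoly_sum_monomials:
  "p = (\<Sum>m\<in>Poly_Mapping.keys p.
          poly_scale (Poly_Mapping.lookup p m) (Poly_Mapping.single m 1))"
  using sum_monomials[of p] by (simp add: poly_scale_single)

lemma mulX_eq: "mulX v p = (\<Sum>j\<in>UNIV. poly_scale (v $ j) (var j * p))"
  by (simp add: mulX_def var_def unit_exp_def sum_distrib_right poly_scale_mult_left)


lemma peval_superset:
  assumes "finite A" "Poly_Mapping.keys p \<subseteq> A"
  shows "peval p x = (\<Sum>m\<in>A. Poly_Mapping.lookup p m *
           (\<Prod>i\<in>UNIV. complex_of_real (x $ i) ^ Poly_Mapping.lookup m i))"
  unfolding peval_def using assms by (intro sum.mono_neutral_left) (auto simp: in_keys_iff)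

lemma peval_add: "peval (p + q) x = peval p x + peval q x"
  using peval_superset[of "Poly_Mapping.keys p \<union> Poly_Mapping.keys q" "p + q" x]
    peval_superset[of "Poly_Mapping.keys p \<union> Poly_Mapping.keys q" p x]
    peval_superset[of "Poly_Mapping.keys p \<union> Poly_Mapping.keys q" q x]
    Poly_Mapping.keys_add[of p q]
  by (simp add: lookup_add sum.distrib distrib_right)

lemma peval_0: "peval 0 x = 0"
  by (simp add: peval_def)

lemma peval_sum: "peval (\<Sum>a\<in>A. f a) x = (\<Sum>a\<in>A. peval (f a) x)"
  by (induction A rule: infinite_finite_induct) (simp_all add: peval_0 peval_add)

lemma peval_single:
  "peval (Poly_Mapping.single m c) x =
     c * (\<Prod>i\<in>UNIV. complex_of_real (x $ i) ^ Poly_Mapping.lookup m i)"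
  by (simp add: peval_def)

lemma peval_mult: "peval (p * q) x = peval p x * peval q x"
proof -
  let ?l = "Poly_Mapping.lookup" and ?k = "Poly_Mapping.keys"
  have "p * q = (\<Sum>m\<in>?k p. \<Sum>m'\<in>?k q. Poly_Mapping.single (m + m') (?l p m * ?l q m'))"
    by (subst (1) sum_monomials[of p], subst (1) sum_monomials[of q])
      (simp add: sum_product mult_single)
  then have "peval (p * q) x = (\<Sum>m\<in>?k p. \<Sum>m'\<in>?k q.
      peval (Poly_Mapping.single m (?l p m)) x * peval (Poly_Mapping.single m' (?l q m')) x)"
    by (simp add: peval_sum peval_single lookup_add power_add prod.distrib mult_ac)
  also have "\<dots> = peval p x * peval q x"
    by (simp add: peval_def[of p] peval_def[of q] peval_single sum_product mult_ac)
  finally show ?thesis .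
qed

lemma peval_scale: "peval (poly_scale c p) x = c * peval p x"
  by (simp add: poly_scale_def peval_mult peval_single)

lemma peval_diff: "peval (p - q) x = peval p x - peval q x"
  using peval_add[of "p - q" q x] by simp

lemma peval_1: "peval 1 x = 1"
  using peval_single[of 0 1 x] by simp

lemma peval_prod: "peval (\<Prod>a\<in>A. f a) x = (\<Prod>a\<in>A. peval (f a) x)"
  by (induction A rule: infinite_finite_induct) (simp_all add: peval_1 peval_mult)

lemma lookup_unit_exp: "Poly_Mapping.lookup (unit_exp j) i = of_bool (i = j)"
  by (auto simp: unit_exp_def lookup_single when_def)

lemma peval_var: "peval (var j) x = complex_of_real (x $ j)"
proof -
  have "(\<Prod>i\<in>UNIV. complex_of_real (x $ i) ^ Poly_Mapping.lookup (unit_exp j) i) =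
      (\<Prod>i\<in>UNIV. if i = j then complex_of_real (x $ j) else 1)"
    by (intro prod.cong) (auto simp: lookup_unit_exp)
  then show ?thesis
    by (simp add: var_def peval_single)
qed

lemma mdeg_0 [simp]: "mdeg 0 = 0"
  by (simp add: mdeg_def)

lemma mdeg_add [simp]: "mdeg (m + m') = mdeg m + mdeg m'"
  by (simp add: mdeg_def lookup_add sum.distrib)

lemma mdeg_unit_exp [simp]: "mdeg (unit_exp j) = 1"
  by (simp add: mdeg_def lookup_unit_exp of_bool_def)

lemma mdeg_eq_0_iff [simp]: "mdeg m = 0 \<longleftrightarrow> m = 0"
  by (auto simp: mdeg_def intro!: poly_mapping_eqI)

lemma minus_unit_exp_add:
  "Poly_Mapping.lookup m j > 0 \<Longrightarrow> m - unit_exp j + unit_exp j = m"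
  by (auto intro!: poly_mapping_eqI simp: lookup_add lookup_minus lookup_unit_exp)

text \<open>
  Raising one exponent by one reaches every exponent vector, so statements about monomials follow
  from their behaviour under multiplication by a single variable.
\<close>

lemma exponent_induct [case_names zero step]:
  assumes "P 0" "\<And>m j. P m \<Longrightarrow> P (m + unit_exp j)"
  shows "P (m :: 'd::finite \<Rightarrow>\<^sub>0 nat)"
proof (induction "mdeg m" arbitrary: m)
  case 0
  then show ?case using assms(1) by simp
next
  case (Suc n)
  then obtain j where j: "Poly_Mapping.lookup m j > 0"
    unfolding mdeg_def by (metis bot_nat_0.not_eq_extremum sum.neutral nat.distinct(1))
  have m: "m = (m - unit_exp j) + unit_exp j"
    using j by (rule minus_unit_exp_add[symmetric])
  then have "mdeg m = mdeg (m - unit_exp j) + 1"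
    by (metis mdeg_add mdeg_unit_exp)
  then have "P (m - unit_exp j)" using Suc by simp
  then show ?case using assms(2) m by metis
qed

lemma exponent_cases:
  obtains "m = 0" | m' j where "m = m' + unit_exp j"
proof -
  have "m = 0 \<or> (\<exists>m' j. m = m' + unit_exp j)"
    by (induction m rule: exponent_induct) blast+
  then show ?thesis using that by blast
qed

lemma polys_le_subspace: "cpoly.subspace (polys_le k)"
proof (rule cpoly.subspaceI)
  show "0 \<in> polys_le k" by (simp add: polys_le_iff_mdeg)
next
  fix p q :: "'a cpoly" assume "p \<in> polys_le k" "q \<in> polys_le k"
  then show "p + q \<in> polys_le k"
    using Poly_Mapping.keys_add[of p q] by (auto simp: polys_le_iff_mdeg)
next
  fix c and p :: "'a cpoly" assume "p \<in> polys_le k"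
  then show "poly_scale c p \<in> polys_le k"
    by (auto simp: polys_le_iff_mdeg in_keys_iff lookup_poly_scale)
qed

lemma polys_le_mono: "k \<le> l \<Longrightarrow> polys_le k \<subseteq> polys_le l"
  by (fastforce simp: polys_le_iff_mdeg)

lemma var_mult_polys_le:
  assumes "p \<in> polys_le k"
  shows "var j * p \<in> polys_le (k + 1)"
proof -
  have "int (mdeg m) \<le> k + 1" if "m \<in> Poly_Mapping.keys (var j * p)" for m
  proof -
    have "m \<in> {unit_exp j + b |b. b \<in> Poly_Mapping.keys p}"
      using that Poly_Mapping.keys_mult[of "var j" p] by (auto simp: var_def)
    then obtain m' where "m' \<in> Poly_Mapping.keys p" "m = unit_exp j + m'"
      by blast
    then show ?thesis using assms
      by (auto simp: polys_le_iff_mdeg)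
  qed
  then show ?thesis by (simp add: polys_le_iff_mdeg)
qed

lemma var_mult_polys_le':
  assumes "p \<in> polys_le (int n)"
  shows "var j * p \<in> polys_le (int (Suc n))"
  using var_mult_polys_le[OF assms] by (simp add: add.commute)

lemma ex_polys_le: "\<exists>n. p \<in> polys_le (int n)"
proof -
  have "int (mdeg m) \<le> int (\<Sum>m\<in>Poly_Mapping.keys p. mdeg m)" if "m \<in> Poly_Mapping.keys p" for m
    using that member_le_sum[of m "Poly_Mapping.keys p" mdeg] by (simp del: of_nat_sum)
  then show ?thesis using polys_le_iff_mdeg by blast
qed

text \<open>
  A basis tensor is indexed by a list of indices, a monomial by an exponent vector. Applying the
  creation operators along a list only remembers how often each index occurs, which is the exponent
  vector recorded here; two lists are equivalent tuples exactly if these vectors agree.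
\<close>

definition exponent :: "'d::finite list \<Rightarrow> ('d \<Rightarrow>\<^sub>0 nat)" where
  "exponent i = (\<Sum>l\<leftarrow>i. unit_exp l)"

lemma exponent_simps [simp]:
  "exponent [] = 0" "exponent (l # i) = unit_exp l + exponent i"
  by (simp_all add: exponent_def)

lemma lookup_exponent: "Poly_Mapping.lookup (exponent i) l = count_list i l"
  by (induction i) (simp_all add: lookup_add lookup_unit_exp)

lemma mdeg_exponent [simp]: "mdeg (exponent i) = length i"
  by (induction i) (simp_all add: mdeg_add lookup_add sum.distrib lookup_unit_exp)

lemma exponent_eq_iff: "exponent i = exponent j \<longleftrightarrow> mset i = mset j"
  by (simp add: poly_mapping_eq_iff fun_eq_iff lookup_exponent multiset_eq_iff count_mset)

lemma exponent_permute_list: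
  "\<sigma> permutes {..<length i} \<Longrightarrow> exponent (permute_list \<sigma> i) = exponent i"
  by (simp add: exponent_eq_iff)

lemma exponent_surj: "\<exists>i. exponent i = m"
proof (induction m rule: exponent_induct)
  case zero show ?case by (rule exI[of _ "[]"]) simp
next
  case (step m j)
  then obtain i where "exponent i = m" by blast
  then show ?case by (intro exI[of _ "j # i"]) (simp add: add.commute)
qed

lemma finite_lists_length: "finite {i :: 'd::finite list. length i = n}"
  using finite_lists_length_eq[of "UNIV :: 'd set" n] by simp

lemma finite_mdeg_le: "finite {m :: 'd::finite \<Rightarrow>\<^sub>0 nat. mdeg m \<le> n}"
proof -
  have "{m :: 'd \<Rightarrow>\<^sub>0 nat. mdeg m \<le> n} \<subseteq> exponent ` {i. length i \<le> n}"
  proof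
    fix m :: "'d \<Rightarrow>\<^sub>0 nat" assume m: "m \<in> {m. mdeg m \<le> n}"
    obtain i where "exponent i = m" using exponent_surj by blast
    then show "m \<in> exponent ` {i. length i \<le> n}" using m by (auto intro!: image_eqI[of _ _ i])
  qed
  moreover have "finite {i :: 'd list. length i \<le> n}"
    using finite_lists_length_le[of "UNIV :: 'd set" n] by simp
  ultimately show ?thesis by (meson finite_imageI finite_subset)
qed

lemma finite_mdeg_eq: "finite {m :: 'd::finite \<Rightarrow>\<^sub>0 nat. mdeg m = n}"
  by (rule finite_subset[OF _ finite_mdeg_le[of n]]) auto


section \<open>Orthogonal families with a three-term recurrence\<close>

text \<open>
  The Jacobi sequences depend on the measure only through an orthogonal basis of polynomials and
  the way in which the variables act on it. The recurrence below is the three-term recurrence of a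
  product basis: multiplication by a variable raises or lowers exactly one index and has no diagonal
  part. Since subtraction of exponent vectors is truncated, the lowering coefficient must vanish
  when there is nothing to lower.
\<close>

locale orthogonal_family =
  fixes \<mu> :: "(real ^ 'd::finite) measure"
    and Q :: "('d \<Rightarrow>\<^sub>0 nat) \<Rightarrow> 'd cpoly"
    and \<omega> :: "'d \<Rightarrow> ('d \<Rightarrow>\<^sub>0 nat) \<Rightarrow> complex"
    and h :: "('d \<Rightarrow>\<^sub>0 nat) \<Rightarrow> real"
  assumes integrable: "\<And>p q. integrable \<mu> (\<lambda>x. cnj (peval p x) * peval q x)"
    and Q_0: "Q 0 = 1"
    and recurrence:
      "var j * Q m = Q (m + unit_exp j) + poly_scale (\<omega> j m) (Q (m - unit_exp j))"
    and boundary: "Poly_Mapping.lookup m j = 0 \<Longrightarrow> \<omega> j m = 0"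
    and pip_Q: "pip \<mu> (Q m) (Q m') = (if m = m' then complex_of_real (h m) else 0)"
    and h_pos: "h m > 0"
begin

lemma pip_add_right: "pip \<mu> p (q + r) = pip \<mu> p q + pip \<mu> p r"
  by (simp add: pip_def peval_add distrib_left integrable)

lemma pip_scale_right: "pip \<mu> p (poly_scale c q) = c * pip \<mu> p q"
  by (simp add: pip_def peval_scale mult.left_commute)

lemma pip_cnj: "cnj (pip \<mu> p q) = pip \<mu> q p"
proof -
  have "pip \<mu> q p = (LINT x|\<mu>. cnj (cnj (peval p x) * peval q x))"
    by (simp add: pip_def mult.commute)
  then show ?thesis
    unfolding pip_def by (simp only: Bochner_Integration.integral_cnj)
qed

lemma pip_add_left: "pip \<mu> (p + q) r = pip \<mu> p r + pip \<mu> q r"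
  by (metis complex_cnj_add pip_add_right pip_cnj)

lemma pip_scale_left: "pip \<mu> (poly_scale c p) q = cnj c * pip \<mu> p q"
  by (metis complex_cnj_mult pip_scale_right pip_cnj)

lemma pip_zero_left: "pip \<mu> 0 q = 0"
  by (simp add: pip_def peval_0)

lemma pip_sum_left: "pip \<mu> (\<Sum>a\<in>A. f a) q = (\<Sum>a\<in>A. pip \<mu> (f a) q)"
  by (induction A rule: infinite_finite_induct) (simp_all add: pip_zero_left pip_add_left)

text \<open>
  The coordinate of a polynomial along \<open>Q m\<close>. All spaces and projections of the orthogonal gradation
  have a description by coordinates, so that identities between polynomials reduce to comparing them.
\<close>

definition coef :: "('d \<Rightarrow>\<^sub>0 nat) \<Rightarrow> 'd cpoly \<Rightarrow> complex" where
  "coef m p = pip \<mu> (Q m) p / complex_of_real (h m)"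

lemma pip_Q_left: "pip \<mu> (Q m) p = complex_of_real (h m) * coef m p"
  using h_pos[of m] by (simp add: coef_def)

lemma coef_add: "coef m (p + q) = coef m p + coef m q"
  by (simp add: coef_def pip_add_right add_divide_distrib)

lemma coef_scale: "coef m (poly_scale c p) = c * coef m p"
  by (simp add: coef_def pip_scale_right)

lemma coef_0: "coef m 0 = 0"
  by (simp add: coef_def pip_def peval_0)

lemma coef_diff: "coef m (p - q) = coef m p - coef m q"
  using coef_add[of m "p - q" q] by simp

lemma coef_sum: "coef m (\<Sum>a\<in>A. f a) = (\<Sum>a\<in>A. coef m (f a))"
  by (induction A rule: infinite_finite_induct) (simp_all add: coef_0 coef_add)

lemma coef_Q: "coef m (Q m') = of_bool (m = m')"
  using h_pos[of m] by (auto simp: coef_def pip_Q)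

lemmas coef_linear = coef_add coef_diff coef_scale coef_0 coef_sum

text \<open>
  Solving the recurrence for \<open>Q (m' + unit_exp j)\<close> expresses it by members of lower degree.
\<close>

lemma Q_in_polys_le: "Q m \<in> polys_le (int (mdeg m))"
proof (induction "mdeg m" arbitrary: m rule: less_induct)
  case less
  show ?case
  proof (cases m rule: exponent_cases)
    case 1
    then show ?thesis by (simp add: Q_0 polys_le_iff_mdeg flip: single_one)
  next
    case (2 m' j)
    have deg: "mdeg m = Suc (mdeg m')"
      using 2 by simp
    have m: "Q m = var j * Q m' - poly_scale (\<omega> j m') (Q (m' - unit_exp j))"
      using recurrence[of j m'] 2 by simp
    have "var j * Q m' \<in> polys_le (int (mdeg m))"
      using var_mult_polys_le'[OF less[of m']] deg by simp
    moreover have "poly_scale (\<omega> j m') (Q (m' - unit_exp j)) \<in> polys_le (int (mdeg m))"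
    proof (cases "Poly_Mapping.lookup m' j = 0")
      case True
      then show ?thesis by (simp add: boundary cpoly.subspace_0[OF polys_le_subspace])
    next
      case False
      then have "mdeg (m' - unit_exp j) + 1 = mdeg m'"
        by (metis minus_unit_exp_add mdeg_add mdeg_unit_exp bot_nat_0.not_eq_extremum)
      then show ?thesis
        using less[of "m' - unit_exp j"] deg polys_le_mono[of "int (mdeg (m' - unit_exp j))" "int (mdeg m)"]
        by (intro cpoly.subspace_scale[OF polys_le_subspace]) auto
    qed
    ultimately show ?thesis
      unfolding m by (rule cpoly.subspace_diff[OF polys_le_subspace])
  qed
qed

lemma var_mult_span:
  assumes "p \<in> cpoly.span (Q ` {m. mdeg m \<le> n})"
  shows "var j * p \<in> cpoly.span (Q ` {m. mdeg m \<le> Suc n})"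
  using assms
proof (induction rule: cpoly.span_induct)
  case base
  show ?case
  proof (rule cpoly.subspaceI)
    show "0 \<in> {p. var j * p \<in> cpoly.span (Q ` {m. mdeg m \<le> Suc n})}"
      by (simp add: cpoly.span_zero)
  qed (simp_all add: distrib_left poly_scale_mult_right cpoly.span_add cpoly.span_scale)
next
  case (step p)
  then obtain m where m: "p = Q m" "mdeg m \<le> n" by blast
  have "poly_scale (\<omega> j m) (Q (m - unit_exp j)) \<in> cpoly.span (Q ` {m. mdeg m \<le> Suc n})"
  proof (cases "Poly_Mapping.lookup m j = 0")
    case True
    then show ?thesis by (simp add: boundary cpoly.span_zero)
  next
    case False
    then have "mdeg (m - unit_exp j) + 1 = mdeg m"
      by (metis minus_unit_exp_add mdeg_add mdeg_unit_exp bot_nat_0.not_eq_extremum)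
    then show ?thesis
      using m by (intro cpoly.span_scale cpoly.span_base) auto
  qed
  moreover have "Q (m + unit_exp j) \<in> cpoly.span (Q ` {m. mdeg m \<le> Suc n})"
    using m by (intro cpoly.span_base) auto
  ultimately show ?case
    using m recurrence[of j m] by (simp add: cpoly.span_add)
qed

text \<open>
  Multiplication by a variable keeps the span of the family and raises the degree bound by one, so
  the monomials are reached one variable at a time.
\<close>

lemma monomial_in_span:
  "Poly_Mapping.single m (1::complex) \<in> cpoly.span (Q ` {m'. mdeg m' \<le> mdeg m})"
proof (induction m rule: exponent_induct)
  case zero
  show ?case using Q_0 by (auto intro!: cpoly.span_base image_eqI[of _ _ 0])
next
  case (step m j)
  have "Poly_Mapping.single (m + unit_exp j) 1 = var j * Poly_Mapping.single m (1::complex)"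
    by (simp add: var_def mult_single add.commute)
  then show ?case using var_mult_span[OF step, of j] by simp
qed

lemma polys_le_subset_span: "polys_le (int n) \<subseteq> cpoly.span (Q ` {m. mdeg m \<le> n})"
proof
  fix p :: "'d cpoly" assume p: "p \<in> polys_le (int n)"
  have "Poly_Mapping.single m (1::complex) \<in> cpoly.span (Q ` {m. mdeg m \<le> n})"
    if "m \<in> Poly_Mapping.keys p" for m
  proof -
    have "mdeg m \<le> n" using p that by (auto simp: polys_le_iff_mdeg)
    then have "Q ` {m'. mdeg m' \<le> mdeg m} \<subseteq> Q ` {m. mdeg m \<le> n}" by auto
    then show ?thesis using monomial_in_span[of m] cpoly.span_mono by blast
  qed
  then show "p \<in> cpoly.span (Q ` {m. mdeg m \<le> n})"
    by (subst cpoly_sum_monomials) (intro cpoly.span_sum cpoly.span_scale)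
qed

lemma expansion:
  assumes "p \<in> polys_le (int n)"
  shows "p = (\<Sum>m | mdeg m \<le> n. poly_scale (coef m p) (Q m))"
proof -
  have "p \<in> cpoly.span (Q ` {m. mdeg m \<le> n})"
    using assms polys_le_subset_span by blast
  then show ?thesis
  proof (induction rule: cpoly.span_induct)
    case base
    show ?case
    proof (rule cpoly.subspaceI, goal_cases)
      case (2 p q)
      then show ?case
        by (simp add: coef_add cpoly.scale_left_distrib sum.distrib)
    next
      case (3 c p)
      then have "poly_scale c p = poly_scale c (\<Sum>m | mdeg m \<le> n. poly_scale (coef m p) (Q m))"
        by simp
      then have "poly_scale c p = (\<Sum>m | mdeg m \<le> n. poly_scale (c * coef m p) (Q m))"
        by (simp only: cpoly.scale_sum_right cpoly.scale_scale)
      then show ?case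
        unfolding mem_Collect_eq coef_scale .
    qed (simp add: coef_0)
  next
    case (step p)
    then obtain m where m: "p = Q m" "mdeg m \<le> n" by blast
    have "(\<Sum>m' | mdeg m' \<le> n. poly_scale (coef m' (Q m)) (Q m')) =
        (\<Sum>m' | mdeg m' \<le> n. if m' = m then Q m else 0)"
      by (intro sum.cong) (auto simp: coef_Q)
    then show ?case using m by (simp add: finite_mdeg_le)
  qed
qed

text \<open>
  The coordinates separate polynomials: the family is a basis, since it spans and is orthogonal.
\<close>

lemma coef_eqI:
  assumes "\<And>m. coef m p = coef m q"
  shows "p = q"
proof -
  obtain n where "p - q \<in> polys_le (int n)"
    using ex_polys_le by blast
  from expansion[OF this] show ?thesis
    using assms by (simp add: coef_diff)
qed

lemma polys_le_iff_coef: "p \<in> polys_le k \<longleftrightarrow> (\<forall>m. coef m p \<noteq> 0 \<longrightarrow> int (mdeg m) \<le> k)"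
proof
  assume p: "p \<in> polys_le k"
  show "\<forall>m. coef m p \<noteq> 0 \<longrightarrow> int (mdeg m) \<le> k"
  proof (cases "k \<ge> 0")
    case True
    then have "p = (\<Sum>m | mdeg m \<le> nat k. poly_scale (coef m p) (Q m))"
      using expansion[of p "nat k"] p by simp
    then have "coef m p = (\<Sum>m' | mdeg m' \<le> nat k. coef m' p * of_bool (m = m'))" for m
      by (metis (no_types, lifting) coef_sum coef_scale coef_Q sum.cong)
    moreover have "(\<Sum>m' | mdeg m' \<le> nat k. coef m' p * of_bool (m = m')) = 0"
      if "\<not> int (mdeg m) \<le> k" for m
      using that True by (intro sum.neutral) auto
    ultimately show ?thesis
      by metis
  next
    case False
    then have "Poly_Mapping.keys p = {}"
      using p by (fastforce simp: polys_le_iff_mdeg)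
    then show ?thesis by (simp add: coef_0)
  qed
next
  assume *: "\<forall>m. coef m p \<noteq> 0 \<longrightarrow> int (mdeg m) \<le> k"
  obtain n where n: "p \<in> polys_le (int n)"
    using ex_polys_le by blast
  have "poly_scale (coef m p) (Q m) \<in> polys_le k" for m
    using * Q_in_polys_le[of m] polys_le_mono[of "int (mdeg m)" k]
    by (cases "coef m p = 0")
      (auto simp: cpoly.subspace_0[OF polys_le_subspace]
        intro!: cpoly.subspace_scale[OF polys_le_subspace])
  then show "p \<in> polys_le k"
    by (subst expansion[OF n]) (intro cpoly.subspace_sum[OF polys_le_subspace])
qed

text \<open>
  Parseval's identity; the degree bound only serves to make the sum finite.
\<close>

lemma pip_expansion:
  assumes "p \<in> polys_le (int n)"
  shows "pip \<mu> p q =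
    (\<Sum>m | mdeg m \<le> n. cnj (coef m p) * complex_of_real (h m) * coef m q)"
  using arg_cong[OF expansion[OF assms], of "\<lambda>p. pip \<mu> p q"]
  by (simp add: pip_sum_left pip_scale_left pip_Q_left mult.assoc)

text \<open>
  By orthogonality, being orthogonal to all polynomials of lower degree means having no coordinates
  there; hence the homogeneous component of degree \<open>n\<close> is spanned by the \<open>Q m\<close> with
  \<open>mdeg m = n\<close>.
\<close>

lemma orth_polys_iff: "p \<in> orth_polys \<mu> n \<longleftrightarrow> (\<forall>m. coef m p \<noteq> 0 \<longrightarrow> mdeg m = n)"
proof
  assume p: "p \<in> orth_polys \<mu> n"
  show "\<forall>m. coef m p \<noteq> 0 \<longrightarrow> mdeg m = n"
  proof (intro allI impI)
    fix m assume m: "coef m p \<noteq> 0"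
    then have le: "mdeg m \<le> n"
      using p polys_le_iff_coef[of p "int n"] by (auto simp: orth_polys_def)
    have "\<not> mdeg m < n"
    proof
      assume "mdeg m < n"
      then have "Q m \<in> polys_le (int n - 1)"
        using Q_in_polys_le[of m] polys_le_mono[of "int (mdeg m)" "int n - 1"] by auto
      then show False using p m by (auto simp: orth_polys_def coef_def)
    qed
    with le show "mdeg m = n" by simp
  qed
next
  assume *: "\<forall>m. coef m p \<noteq> 0 \<longrightarrow> mdeg m = n"
  have "pip \<mu> q p = 0" if q: "q \<in> polys_le (int n - 1)" for q
  proof -
    obtain N where N: "q \<in> polys_le (int N)"
      using ex_polys_le by blast
    have "coef m q = 0 \<or> coef m p = 0" for m
      using q * by (force simp: polys_le_iff_coef)
    then show ?thesis
      by (subst pip_expansion[OF N]) (intro sum.neutral, auto)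
  qed
  then show "p \<in> orth_polys \<mu> n"
    using * by (auto simp: orth_polys_def polys_le_iff_coef)
qed

lemma orth_polys_subspace: "cpoly.subspace (orth_polys \<mu> n)"
proof (rule cpoly.subspaceI, goal_cases)
  case (2 p q)
  then show ?case unfolding orth_polys_iff coef_add by (metis add.right_neutral)
qed (auto simp: orth_polys_iff coef_linear)

lemma Q_in_orth_polys: "Q m \<in> orth_polys \<mu> n \<longleftrightarrow> mdeg m = n"
  by (auto simp: orth_polys_iff coef_Q)

lemma coef_partial_sum:
  "coef m (\<Sum>m' | mdeg m' = n. poly_scale (c m') (Q m')) = (if mdeg m = n then c m else 0)"
  by (auto simp: finite_mdeg_eq coef_sum coef_scale coef_Q of_bool_def if_distrib cong: if_cong)

text \<open>
  The definite description of the projection has the truncated coordinate expansion as its unique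
  solution; uniqueness holds because each \<open>Q m\<close> of degree \<open>n\<close> is an admissible test vector.
\<close>

lemma proj_eq: "proj \<mu> n p = (\<Sum>m | mdeg m = n. poly_scale (coef m p) (Q m))"
  unfolding proj_def
proof (rule the_equality, goal_cases)
  case 1
  let ?r = "\<Sum>m | mdeg m = n. poly_scale (coef m p) (Q m)"
  have "pip \<mu> s (p - ?r) = 0" if s: "s \<in> orth_polys \<mu> n" for s
  proof -
    obtain N where N: "s \<in> polys_le (int N)"
      using ex_polys_le by blast
    have "coef m s = 0 \<or> coef m (p - ?r) = 0" for m
      using s by (auto simp: orth_polys_iff coef_diff coef_partial_sum)
    then show ?thesis
      by (subst pip_expansion[OF N]) (intro sum.neutral, auto)
  qed
  then show ?case
    by (auto simp: orth_polys_iff coef_partial_sum split: if_splits)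
next
  case (2 r)
  have "coef m r = (if mdeg m = n then coef m p else 0)" for m
  proof (cases "mdeg m = n")
    case True
    then have "coef m (p - r) = 0"
      using 2 Q_in_orth_polys[of m n] by (simp add: coef_def)
    then show ?thesis using True by (simp add: coef_diff)
  next
    case False
    then show ?thesis using 2 by (auto simp: orth_polys_iff)
  qed
  then show ?case by (intro coef_eqI) (simp add: coef_partial_sum)
qed

lemma coef_proj: "coef m (proj \<mu> n p) = (if mdeg m = n then coef m p else 0)"
  by (simp add: proj_eq coef_partial_sum)

lemma proj_add: "proj \<mu> n (p + q) = proj \<mu> n p + proj \<mu> n q"
  by (rule coef_eqI) (simp add: coef_proj coef_linear)

lemma proj_scale: "proj \<mu> n (poly_scale c p) = poly_scale c (proj \<mu> n p)"
  by (rule coef_eqI) (simp add: coef_proj coef_linear)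

lemma proj_0: "proj \<mu> n 0 = 0"
  by (rule coef_eqI) (simp add: coef_proj coef_linear)

lemma proj_sum: "proj \<mu> n (\<Sum>a\<in>A. f a) = (\<Sum>a\<in>A. proj \<mu> n (f a))"
  by (induction A rule: infinite_finite_induct) (simp_all add: proj_0 proj_add)

lemma proj_orth_polys:
  assumes "p \<in> orth_polys \<mu> k"
  shows "proj \<mu> n p = (if n = k then p else 0)"
  using assms by (intro coef_eqI) (auto simp: coef_proj coef_linear orth_polys_iff)

lemma proj_Suc_var_mult_Q:
  assumes "mdeg m = n"
  shows "proj \<mu> (Suc n) (var j * Q m) = Q (m + unit_exp j)"
proof -
  have "Q (m + unit_exp j) \<in> orth_polys \<mu> (Suc n)"
    using assms by (simp add: Q_in_orth_polys)
  moreover have "proj \<mu> (Suc n) (poly_scale (\<omega> j m) (Q (m - unit_exp j))) = 0"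
  proof (cases "Poly_Mapping.lookup m j = 0")
    case True
    then show ?thesis by (simp add: boundary proj_0)
  next
    case False
    then have "Suc (mdeg (m - unit_exp j)) = n"
      by (metis assms minus_unit_exp_add mdeg_add mdeg_unit_exp bot_nat_0.not_eq_extremum
          Suc_eq_plus1)
    then show ?thesis
      using proj_orth_polys[of "Q (m - unit_exp j)" "mdeg (m - unit_exp j)" "Suc n"]
      by (auto simp: proj_scale Q_in_orth_polys)
  qed
  ultimately show ?thesis
    by (simp add: recurrence proj_add proj_orth_polys)
qed

lemma proj_same_var_mult_Q:
  assumes "mdeg m = n"
  shows "proj \<mu> n (var j * Q m) = 0"
proof -
  have "proj \<mu> n (Q (m + unit_exp j)) = 0"
    using assms proj_orth_polys[of "Q (m + unit_exp j)" "Suc n" n] by (simp add: Q_in_orth_polys)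
  moreover have "proj \<mu> n (poly_scale (\<omega> j m) (Q (m - unit_exp j))) = 0"
  proof (cases "Poly_Mapping.lookup m j = 0")
    case True
    then show ?thesis by (simp add: boundary proj_0)
  next
    case False
    then have "Suc (mdeg (m - unit_exp j)) = n"
      by (metis assms minus_unit_exp_add mdeg_add mdeg_unit_exp bot_nat_0.not_eq_extremum
          Suc_eq_plus1)
    then show ?thesis
      using proj_orth_polys[of "Q (m - unit_exp j)" "mdeg (m - unit_exp j)" n]
      by (auto simp: proj_scale Q_in_orth_polys)
  qed
  ultimately show ?thesis
    by (simp add: recurrence proj_add)
qed

text \<open>
  The recurrence moves the degree by exactly one, up or down, so no part of \<open>X\<^sub>v Q m\<close> has the degree
  of \<open>Q m\<close>.
\<close>

lemma preservation_eq_0: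
  assumes "p \<in> orth_polys \<mu> n"
  shows "preservation \<mu> v n p = 0"
proof -
  have p: "p = (\<Sum>m | mdeg m = n. poly_scale (coef m p) (Q m))"
    using proj_orth_polys[OF assms, of n] proj_eq[of n p] by simp
  have "mulX v p = (\<Sum>j\<in>UNIV. \<Sum>m | mdeg m = n.
      poly_scale (v $ j) (poly_scale (coef m p) (var j * Q m)))"
    unfolding mulX_eq by (subst p)
      (simp only: sum_distrib_left poly_scale_mult_right cpoly.scale_sum_right)
  then have "proj \<mu> n (mulX v p) = 0"
    by (simp add: proj_sum proj_scale proj_same_var_mult_Q del: cpoly.scale_scale)
  then show ?thesis
    using assms by (simp add: preservation_def proj_orth_polys)
qed

lemma creation_orth_polys:
  assumes "p \<in> orth_polys \<mu> n"
  shows "creation \<mu> v p = proj \<mu> (Suc n) (mulX v p)"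
proof -
  have "proj \<mu> (k + 1) (mulX v (proj \<mu> k p)) =
      (if k = n then proj \<mu> (Suc n) (mulX v p) else 0)" for k
    using assms by (simp add: proj_orth_polys mulX_def proj_0)
  then have "creation \<mu> v p = Sum_any (\<lambda>k. if k = n then proj \<mu> (Suc n) (mulX v p) else 0)"
    by (simp add: creation_def)
  also have "\<dots> = proj \<mu> (Suc n) (mulX v p)"
    by (subst Sum_any.expand_superset[of "{n}"]) auto
  finally show ?thesis .
qed

text \<open>
  Only the raising part of the recurrence survives the projection, with coefficient one.
\<close>

lemma creation_sum_Q:
  assumes "\<And>a. a \<in> A \<Longrightarrow> mdeg (m a) = n"
  shows "creation \<mu> v (\<Sum>a\<in>A. poly_scale (c a) (Q (m a))) =
    (\<Sum>j\<in>UNIV. \<Sum>a\<in>A. poly_scale (v $ j * c a) (Q (unit_exp j + m a)))"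
proof -
  let ?p = "\<Sum>a\<in>A. poly_scale (c a) (Q (m a))"
  have "?p \<in> orth_polys \<mu> n"
    by (intro cpoly.subspace_sum cpoly.subspace_scale orth_polys_subspace)
      (simp add: Q_in_orth_polys assms)
  then have "creation \<mu> v ?p = proj \<mu> (Suc n) (mulX v ?p)"
    by (rule creation_orth_polys)
  also have "\<dots> = (\<Sum>j\<in>UNIV. \<Sum>a\<in>A.
      poly_scale (v $ j) (poly_scale (c a) (proj \<mu> (Suc n) (var j * Q (m a)))))"
    by (simp only: mulX_eq sum_distrib_left poly_scale_mult_right cpoly.scale_sum_right
        proj_sum proj_scale)
  also have "\<dots> = (\<Sum>j\<in>UNIV. \<Sum>a\<in>A. poly_scale (v $ j * c a) (Q (unit_exp j + m a)))"
    by (intro sum.cong refl) (simp add: proj_Suc_var_mult_Q assms add.commute)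
  finally show ?thesis .
qed

end


section \<open>Symmetric tensors\<close>

lemma sum_fun_apply: "(\<Sum>a\<in>A. f a) x = (\<Sum>a\<in>A. f a x)"
  by (induction A rule: infinite_finite_induct) simp_all

lemma bij_permute_list:
  assumes \<sigma>: "\<sigma> permutes {..<n}"
  shows "bij_betw (permute_list \<sigma>) {i. length i = n} {i. length i = n}"
proof -
  have *: "permute_list (inv \<sigma>) (permute_list \<sigma> i) = i" "permute_list \<sigma> (permute_list (inv \<sigma>) i) = i"
    if "length i = n" for i :: "'a list"
    using permute_list_compose[of "inv \<sigma>" i \<sigma>] permute_list_compose[of \<sigma> i "inv \<sigma>"] that
      \<sigma> permutes_inv[OF \<sigma>] permutes_inv_o[OF \<sigma>] by auto
  show ?thesis
    by (rule bij_betw_byWitness[where f' = "permute_list (inv \<sigma>)"]) (use * in auto)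
qed

lemma sum_permute_list:
  assumes "\<sigma> permutes {..<n}"
  shows "(\<Sum>i | length i = n. f (permute_list \<sigma> i)) = (\<Sum>i | length i = n. f i)"
  using sum.reindex_bij_betw[OF bij_permute_list[OF assms], of f] .

text \<open>
  Permuting the vectors and the indices simultaneously only reorders the factors of the product.
\<close>

lemma tensor_prod_permute_list:
  assumes "\<sigma> permutes {..<length vs}"
  shows "tensor_prod (permute_list \<sigma> vs) (permute_list \<sigma> i) = tensor_prod vs i"
proof (cases "length i = length vs")
  case True
  have "(\<Prod>k<length vs. permute_list \<sigma> vs ! k $ (permute_list \<sigma> i ! k)) =
      (\<Prod>k<length vs. vs ! \<sigma> k $ (i ! \<sigma> k))"
    using True assms by (intro prod.cong refl) (simp add: permute_list_nth)
  also have "\<dots> = (\<Prod>k<length vs. vs ! k $ (i ! k))"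
    using prod.permute[OF assms, of "\<lambda>k. vs ! k $ (i ! k)"] by (simp add: o_def)
  finally show ?thesis using True by (simp add: tensor_prod_def)
qed (simp add: tensor_prod_def)

lemma tensor_prod_Nil: "tensor_prod [] [] = 1"
  by (simp add: tensor_prod_def)

lemma tensor_prod_Cons: "tensor_prod (v # vs) (j # i) = v $ j * tensor_prod vs i"
  by (simp add: tensor_prod_def prod.lessThan_Suc_shift del: prod.lessThan_Suc)

abbreviation basis_vectors :: "'d::finite list \<Rightarrow> (complex ^ 'd) list" where
  "basis_vectors \<equiv> map (\<lambda>k. axis k 1)"

lemma tensor_prod_basis_vectors: "tensor_prod (basis_vectors i) j = of_bool (j = i)"
proof (cases "length j = length i")
  case True
  then show ?thesis
    by (induction j i rule: list_induct2)
      (auto simp: tensor_prod_Nil tensor_prod_Cons axis_def)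
qed (auto simp: tensor_prod_def)

lemma card_permutations_lessThan: "card {\<sigma>. \<sigma> permutes {..<n::nat}} = fact n"
  using card_permutations[of "{..<n}" n] by simp

lemma sym_tensors_add: "S \<in> sym_tensors n \<Longrightarrow> T \<in> sym_tensors n \<Longrightarrow> S + T \<in> sym_tensors n"
  by (simp add: sym_tensors_def)

lemma sym_tensors_scale: "T \<in> sym_tensors n \<Longrightarrow> tensor_scale c T \<in> sym_tensors n"
  by (simp add: sym_tensors_def tensor_scale_def)

lemma sym_tensors_0: "0 \<in> sym_tensors n"
  by (simp add: sym_tensors_def)

lemma sym_tensors_sum:
  "(\<And>a. a \<in> A \<Longrightarrow> f a \<in> sym_tensors n) \<Longrightarrow> (\<Sum>a\<in>A. f a) \<in> sym_tensors n"
  by (induction A rule: infinite_finite_induct) (simp_all add: sym_tensors_0 sym_tensors_add)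

lemma sym_tensors_cong:
  assumes "T \<in> sym_tensors n" "length i = n" "mset i = mset j"
  shows "T i = T j"
proof -
  obtain \<sigma> where "\<sigma> permutes {..<length j}" "permute_list \<sigma> j = i"
    using mset_eq_permutation[OF assms(3)] .
  then show ?thesis using assms by (auto simp: sym_tensors_def)
qed

lemma sym_tensorsI:
  assumes "\<And>i. length i \<noteq> n \<Longrightarrow> T i = 0"
    and "\<And>i j. length i = n \<Longrightarrow> mset j = mset i \<Longrightarrow> T j = T i"
  shows "T \<in> sym_tensors n"
  unfolding sym_tensors_def using assms(1) by (auto intro!: assms(2))

lemma sym_prod_sym:
  assumes "length vs = n"
  shows "sym_prod vs \<in> sym_tensors n"
  unfolding sym_tensors_def
proof (intro CollectI conjI allI impI, goal_cases)
  case (1 i)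
  then show ?case using assms by (simp add: sym_prod_def tensor_prod_def)
next
  case (2 \<tau> i)
  have \<tau>: "\<tau> permutes {..<length vs}"
    using 2 assms by simp
  have "(\<Sum>\<sigma> | \<sigma> permutes {..<length vs}. tensor_prod (permute_list \<sigma> vs) (permute_list \<tau> i)) =
      (\<Sum>\<sigma> | \<sigma> permutes {..<length vs}. tensor_prod (permute_list (\<sigma> \<circ> \<tau>) vs) (permute_list \<tau> i))"
    by (rule sum_permutations_compose_right[OF \<tau>])
  also have "\<dots> = (\<Sum>\<sigma> | \<sigma> permutes {..<length vs}. tensor_prod (permute_list \<sigma> vs) i)"
  proof (intro sum.cong refl)
    fix \<sigma> assume "\<sigma> \<in> {\<sigma>. \<sigma> permutes {..<length vs}}"
    then show "tensor_prod (permute_list (\<sigma> \<circ> \<tau>) vs) (permute_list \<tau> i) =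
        tensor_prod (permute_list \<sigma> vs) i"
      using \<tau> tensor_prod_permute_list[of \<tau> "permute_list \<sigma> vs" i]
      by (simp add: permute_list_compose)
  qed
  finally show ?case by (simp add: sym_prod_def)
qed

text \<open>
  Averaging the expansion of a symmetric tensor in the basis tensors over all permutations replaces
  the basis tensors by symmetrized ones. Hence a linear map on symmetric tensors is determined by its
  values on symmetrized products.
\<close>

lemma sym_tensor_expansion:
  assumes T: "T \<in> sym_tensors n"
  shows "T = (\<Sum>i | length i = n. tensor_scale (T i) (sym_prod (basis_vectors i)))"
proof
  fix j :: "'a list"
  show "T j = (\<Sum>i | length i = n. tensor_scale (T i) (sym_prod (basis_vectors i))) j"
  proof (cases "length j = n")
    case True
    have "(\<Sum>i | length i = n. T i * tensor_prod (permute_list \<sigma> (basis_vectors i)) j) = T j"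
      if \<sigma>: "\<sigma> permutes {..<n}" for \<sigma>
    proof -
      have "(\<Sum>i | length i = n. T i * tensor_prod (permute_list \<sigma> (basis_vectors i)) j) =
          (\<Sum>i | length i = n. T (permute_list \<sigma> i) * of_bool (j = permute_list \<sigma> i))"
        using \<sigma> T
        by (intro sum.cong refl)
          (simp add: permute_list_map tensor_prod_basis_vectors sym_tensors_def)
      also have "\<dots> = (\<Sum>i | length i = n. T i * of_bool (j = i))"
        using sum_permute_list[OF \<sigma>, of "\<lambda>i. T i * of_bool (j = i)"] .
      also have "\<dots> = T j"
        using True by (simp add: of_bool_def if_distrib finite_lists_length cong: if_cong)
      finally show ?thesis .
    qed
    then have "(\<Sum>\<sigma> | \<sigma> permutes {..<n}. \<Sum>i | length i = n.
        T i * tensor_prod (permute_list \<sigma> (basis_vectors i)) j) = fact n * T j"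
      by (simp add: card_permutations_lessThan)
    then have "(\<Sum>i | length i = n. T i * (\<Sum>\<sigma> | \<sigma> permutes {..<n}.
        tensor_prod (permute_list \<sigma> (basis_vectors i)) j)) / fact n = T j"
      by (subst (asm) sum.swap) (simp add: sum_distrib_left)
    moreover have "(\<Sum>i | length i = n. tensor_scale (T i) (sym_prod (basis_vectors i))) j =
        (\<Sum>i | length i = n. T i * (\<Sum>\<sigma> | \<sigma> permutes {..<n}.
          tensor_prod (permute_list \<sigma> (basis_vectors i)) j)) / fact n"
      unfolding sum_fun_apply
      by (subst sum_divide_distrib[of _ "{i. length i = n}"], intro sum.cong refl)
        (simp add: tensor_scale_def sym_prod_def)
    ultimately show ?thesis
      by simp
  next
    case False
    then show ?thesis
      using T by (auto simp: sum_fun_apply tensor_scale_def sym_prod_def sym_tensors_def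
          tensor_prod_def intro!: sum.neutral)
  qed
qed

lemma linear_on_sum:
  assumes lin: "linear_on tensor_scale s (sym_tensors n) f" and zero: "\<And>y. s 0 y = 0"
    and A: "\<And>a. a \<in> A \<Longrightarrow> t a \<in> sym_tensors n"
  shows "f (\<Sum>a\<in>A. t a) = (\<Sum>a\<in>A. (f (t a) :: 'b::comm_monoid_add))"
proof -
  have "tensor_scale 0 0 = (0 :: 'a tensor)"
    by (simp add: tensor_scale_def fun_eq_iff)
  then have f0: "f 0 = 0"
    using lin sym_tensors_0[of n] zero unfolding linear_on_def by metis
  show ?thesis
    using A
  proof (induction A rule: infinite_finite_induct)
    case (insert a A)
    then show ?case
      using lin sym_tensors_sum[of A t n] unfolding linear_on_def sum.insert[OF insert(1,2)]
      by (metis insertI1 insertI2)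
  qed (simp_all add: f0)
qed

lemma sum_lists_Suc:
  "(\<Sum>i | length i = Suc n. f i) = (\<Sum>j\<in>UNIV. \<Sum>i | length i = n. f (j # (i :: 'd::finite list)))"
proof -
  have "(\<Sum>i | length i = Suc n. f i) =
      (\<Sum>(j, i)\<in>UNIV \<times> {i. length i = n}. f (j # i))"
    by (rule sum.reindex_bij_witness[where i = "\<lambda>(j, i). j # i" and j = "\<lambda>i. (hd i, tl i)"])
      (auto simp: length_Suc_conv)
  then show ?thesis by (simp add: sum.cartesian_product)
qed

text \<open>
  Testing with the difference of the two tensors gives the vanishing of its norm.
\<close>

lemma tensor_ip_nondegenerate:
  assumes S: "S \<in> sym_tensors n" and T: "T \<in> sym_tensors n"
    and eq: "\<And>\<xi>. \<xi> \<in> sym_tensors n \<Longrightarrow> tensor_ip n \<xi> S = tensor_ip n \<xi> T"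
  shows "S = T"
proof -
  define D where "D = S + tensor_scale (- 1) T"
  have D: "D \<in> sym_tensors n"
    using S T by (simp add: D_def sym_tensors_add sym_tensors_scale)
  have "tensor_ip n D D = 0"
    using eq[OF D] by (simp add: tensor_ip_def D_def tensor_scale_def right_diff_distrib sum_subtractf)
  moreover have "tensor_ip n D D = complex_of_real (\<Sum>i | length i = n. (cmod (D i))\<^sup>2)"
    by (simp add: tensor_ip_def complex_norm_square mult.commute del: of_real_power)
  ultimately have "(\<Sum>i | length i = n. (cmod (D i))\<^sup>2) = 0"
    by (metis of_real_eq_0_iff)
  then have "D i = 0" if "length i = n" for i
    using that finite_lists_length[of n] by (subst (asm) sum_nonneg_eq_0_iff) auto
  then have "S i = T i" for i
    using S T by (cases "length i = n") (auto simp: D_def tensor_scale_def sym_tensors_def)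
  then show ?thesis by blast
qed

lemma tuple_class_eq_iff:
  assumes "length i = n" "length j = n"
  shows "tuple_class n i = tuple_class n j \<longleftrightarrow> exponent i = exponent j"
proof
  assume "tuple_class n i = tuple_class n j"
  moreover have "i \<in> tuple_class n i"
    using assms by (simp add: tuple_class_def tuple_rel_def)
  ultimately have "i \<in> tuple_class n j" by simp
  then show "exponent i = exponent j"
    by (auto simp: tuple_class_def tuple_rel_def exponent_eq_iff multiset_eq_iff count_mset)
next
  assume "exponent i = exponent j"
  then show "tuple_class n i = tuple_class n j"
    using assms
    by (auto simp: tuple_class_def tuple_rel_def exponent_eq_iff multiset_eq_iff count_mset)
qed

lemma sym_prod_permute_list:
  assumes \<tau>: "\<tau> permutes {..<length vs}"
  shows "sym_prod (permute_list \<tau> vs) = sym_prod vs"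
proof
  fix i
  have "(\<Sum>\<sigma> | \<sigma> permutes {..<length vs}. tensor_prod (permute_list \<sigma> (permute_list \<tau> vs)) i) =
      (\<Sum>\<sigma> | \<sigma> permutes {..<length vs}. tensor_prod (permute_list (\<tau> \<circ> \<sigma>) vs) i)"
    by (intro sum.cong refl) (simp add: permute_list_compose)
  also have "\<dots> = (\<Sum>\<sigma> | \<sigma> permutes {..<length vs}. tensor_prod (permute_list \<sigma> vs) i)"
    by (rule setum_permutations_compose_left[OF \<tau>, symmetric])
  finally show "sym_prod (permute_list \<tau> vs) i = sym_prod vs i"
    by (simp add: sym_prod_def)
qed

text \<open>
  Equivalent tuples are permutations of each other, and symmetrization does not see the order of its
  factors, so the choice of a representative does not matter.
\<close>

lemma e_class_tuple_class:
  assumes "length i = n"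
  shows "e_class n (tuple_class n i) = sym_prod (basis_vectors i)"
  unfolding e_class_def
proof (rule the_equality)
  show "\<exists>j. length j = n \<and> tuple_class n i = tuple_class n j \<and>
      sym_prod (basis_vectors i) = sym_prod (basis_vectors j)"
    using assms by blast
next
  fix T assume "\<exists>j. length j = n \<and> tuple_class n i = tuple_class n j \<and>
      T = sym_prod (basis_vectors j)"
  then obtain j where j: "length j = n" "tuple_class n i = tuple_class n j"
    "T = sym_prod (basis_vectors j)" by blast
  then have "mset i = mset j"
    using assms by (simp add: tuple_class_eq_iff exponent_eq_iff)
  then obtain \<sigma> where \<sigma>: "\<sigma> permutes {..<length j}" "permute_list \<sigma> j = i"
    using mset_eq_permutation[of i j] by blast
  then have "sym_prod (basis_vectors i) = sym_prod (permute_list \<sigma> (basis_vectors j))"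
    by (metis permute_list_map)
  then show "T = sym_prod (basis_vectors i)"
    using j \<sigma> by (simp add: sym_prod_permute_list)
qed


section \<open>The Jacobi sequences of an orthogonal family\<close>

text \<open>
  The multinomial coefficient of an exponent vector. A symmetric tensor has the same coordinate at
  all rearrangements of an index list, and these coordinates are added up when the tensor is mapped
  to a polynomial; this is the factor by which they are multiplied.
\<close>

definition rearrangements :: "('d::finite \<Rightarrow>\<^sub>0 nat) \<Rightarrow> nat" where
  "rearrangements m = card {i. exponent i = m}"

lemma rearrangements_pos: "rearrangements (exponent i) > 0"
proof -
  have "{j. exponent j = exponent i} \<subseteq> {j. length j = length i}"
    by (auto simp: exponent_eq_iff dest: mset_eq_length)
  then have "finite {j. exponent j = exponent i}"
    using finite_lists_length finite_subset by blast
  then show ?thesis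
    unfolding rearrangements_def by (subst card_gt_0_iff) auto
qed

context orthogonal_family
begin

text \<open>
  The isomorphism \<open>U\<^sub>n\<close>, extended to all tensors by forgetting the order of the indices. Defined on
  all tensors, it can be applied to the single terms of a symmetrization.
\<close>

definition tensor_to_poly :: "nat \<Rightarrow> 'd tensor \<Rightarrow> 'd cpoly" where
  "tensor_to_poly n T = (\<Sum>i | length i = n. poly_scale (T i) (Q (exponent i)))"

lemma iterated_creation:
  "foldr (creation \<mu>) vs 1 = tensor_to_poly (length vs) (tensor_prod vs)"
proof (induction vs)
  case Nil
  then show ?case by (simp add: tensor_to_poly_def tensor_prod_Nil Q_0)
next
  case (Cons v vs)
  have "foldr (creation \<mu>) (v # vs) 1 = creation \<mu> v (tensor_to_poly (length vs) (tensor_prod vs))"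
    using Cons by simp
  also have "\<dots> = (\<Sum>j\<in>UNIV. \<Sum>i | length i = length vs.
      poly_scale (v $ j * tensor_prod vs i) (Q (unit_exp j + exponent i)))"
    unfolding tensor_to_poly_def by (rule creation_sum_Q[where n = "length vs"]) simp
  also have "\<dots> = tensor_to_poly (length (v # vs)) (tensor_prod (v # vs))"
    by (simp add: tensor_to_poly_def sum_lists_Suc tensor_prod_Cons)
  finally show ?case .
qed

lemma iterated_creation_basis: "foldr (creation \<mu>) (basis_vectors i) 1 = Q (exponent i)"
proof -
  have "(\<Sum>j | length j = length i. poly_scale (of_bool (j = i)) (Q (exponent j))) =
      (\<Sum>j | length j = length i. if j = i then Q (exponent i) else 0)"
    by (intro sum.cong) auto
  then show ?thesis
    by (simp add: iterated_creation tensor_to_poly_def tensor_prod_basis_vectors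
        finite_lists_length)
qed

text \<open>
  The map only sees the exponent vector of an index list, so each term of the symmetrization has the
  same image and averaging changes nothing.
\<close>

lemma tensor_to_poly_sym_prod:
  "tensor_to_poly (length vs) (sym_prod vs) = tensor_to_poly (length vs) (tensor_prod vs)"
proof -
  let ?n = "length vs"
  have *: "tensor_to_poly ?n (tensor_prod (permute_list \<sigma> vs)) =
      tensor_to_poly ?n (tensor_prod vs)" if \<sigma>: "\<sigma> permutes {..<?n}" for \<sigma>
  proof -
    have "tensor_to_poly ?n (tensor_prod (permute_list \<sigma> vs)) =
        (\<Sum>i | length i = ?n. poly_scale (tensor_prod (permute_list \<sigma> vs) (permute_list \<sigma> i))
          (Q (exponent (permute_list \<sigma> i))))"
      unfolding tensor_to_poly_def
      using sum_permute_list[OF \<sigma>, of "\<lambda>i. poly_scale (tensor_prod (permute_list \<sigma> vs) i)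
        (Q (exponent i))"] by simp
    also have "\<dots> = tensor_to_poly ?n (tensor_prod vs)"
      unfolding tensor_to_poly_def using \<sigma>
      by (intro sum.cong refl) (simp add: tensor_prod_permute_list exponent_permute_list)
    finally show ?thesis .
  qed
  have "tensor_to_poly ?n (sym_prod vs) = (\<Sum>i | length i = ?n. \<Sum>\<sigma> | \<sigma> permutes {..<?n}.
      poly_scale (1 / fact ?n) (poly_scale (tensor_prod (permute_list \<sigma> vs) i) (Q (exponent i))))"
    unfolding tensor_to_poly_def sym_prod_def
    by (simp add: sum_divide_distrib cpoly.scale_sum_left)
  also have "\<dots> = (\<Sum>\<sigma> | \<sigma> permutes {..<?n}.
      poly_scale (1 / fact ?n) (tensor_to_poly ?n (tensor_prod (permute_list \<sigma> vs))))"
    unfolding tensor_to_poly_def cpoly.scale_sum_right by (rule sum.swap)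
  also have "\<dots> = (\<Sum>\<sigma> | \<sigma> permutes {..<?n}.
      poly_scale (1 / fact ?n) (tensor_to_poly ?n (tensor_prod vs)))"
    using * by (intro sum.cong refl) simp
  also have "\<dots> = poly_scale (\<Sum>\<sigma> | \<sigma> permutes {..<?n}. 1 / fact ?n)
      (tensor_to_poly ?n (tensor_prod vs))"
    by (rule cpoly.scale_sum_left[symmetric])
  also have "(\<Sum>\<sigma> | \<sigma> permutes {..<?n}. 1 / fact ?n) = (1::complex)"
    by (simp add: card_permutations_lessThan)
  finally show ?thesis by simp
qed

lemma coef_tensor_to_poly:
  assumes T: "T \<in> sym_tensors n" and i: "length i = n"
  shows "coef (exponent i) (tensor_to_poly n T) = of_nat (rearrangements (exponent i)) * T i"
proof -
  have "coef (exponent i) (tensor_to_poly n T) =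
      (\<Sum>j | length j = n. if exponent i = exponent j then T j else 0)"
    by (simp add: tensor_to_poly_def coef_linear coef_Q of_bool_def if_distrib cong: if_cong)
  also have "\<dots> = (\<Sum>j | exponent j = exponent i. T j)"
    using i by (intro sum.mono_neutral_cong_right)
      (auto simp: finite_lists_length exponent_eq_iff dest: mset_eq_length)
  also have "\<dots> = (\<Sum>j | exponent j = exponent i. T i)"
    using T i by (intro sum.cong refl)
      (auto simp: exponent_eq_iff dest: mset_eq_length intro!: sym_tensors_cong)
  finally show ?thesis by (simp add: rearrangements_def)
qed

lemma tensor_to_poly_in_orth_polys: "tensor_to_poly n T \<in> orth_polys \<mu> n"
  unfolding tensor_to_poly_def
  by (intro cpoly.subspace_sum cpoly.subspace_scale orth_polys_subspace)
    (simp add: Q_in_orth_polys)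

lemma tensor_to_poly_add: "tensor_to_poly n (S + T) = tensor_to_poly n S + tensor_to_poly n T"
  by (simp add: tensor_to_poly_def cpoly.scale_left_distrib sum.distrib)

lemma tensor_to_poly_scale: "tensor_to_poly n (tensor_scale c T) = poly_scale c (tensor_to_poly n T)"
  by (simp add: tensor_to_poly_def tensor_scale_def cpoly.scale_sum_right)

text \<open>
  The coordinates of the image are those of the tensor up to the nonzero multinomial factors, and
  every family of coordinates depending only on the exponent vector comes from a symmetric tensor.
\<close>

lemma bij_tensor_to_poly: "bij_betw (tensor_to_poly n) (sym_tensors n) (orth_polys \<mu> n)"
  unfolding bij_betw_def
proof
  show "inj_on (tensor_to_poly n) (sym_tensors n)"
  proof (rule inj_onI)
    fix S T assume ST: "S \<in> sym_tensors n" "T \<in> sym_tensors n"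
      "tensor_to_poly n S = tensor_to_poly n T"
    show "S = T"
    proof
      fix i
      show "S i = T i"
        using ST coef_tensor_to_poly[of S n i] coef_tensor_to_poly[of T n i]
          rearrangements_pos[of i]
        by (cases "length i = n") (auto simp: sym_tensors_def)
    qed
  qed
next
  have "q \<in> tensor_to_poly n ` sym_tensors n" if q: "q \<in> orth_polys \<mu> n" for q
  proof -
    define T :: "'d tensor" where "T = (\<lambda>i. if length i = n
      then coef (exponent i) q / of_nat (rearrangements (exponent i)) else 0)"
    have T: "T \<in> sym_tensors n"
    proof (rule sym_tensorsI)
      fix i j :: "'d list" assume "length i = n" "mset j = mset i"
      moreover from this have "exponent j = exponent i" "length j = length i"
        by (auto simp: exponent_eq_iff dest: mset_eq_length)
      ultimately show "T j = T i" by (simp add: T_def)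
    qed (simp add: T_def)
    have "q = tensor_to_poly n T"
    proof (rule coef_eqI)
      fix m :: "'d \<Rightarrow>\<^sub>0 nat"
      obtain i where m: "m = exponent i"
        using exponent_surj by metis
      show "coef m q = coef m (tensor_to_poly n T)"
      proof (cases "length i = n")
        case True
        then show ?thesis
          using coef_tensor_to_poly[OF T True] rearrangements_pos[of i] m by (simp add: T_def)
      next
        case False
        then have "mdeg m \<noteq> n" using m by simp
        then show ?thesis
          using q tensor_to_poly_in_orth_polys[of n T] unfolding orth_polys_iff by metis
      qed
    qed
    then show ?thesis using T by blast
  qed
  then show "tensor_to_poly n ` sym_tensors n = orth_polys \<mu> n"
    using tensor_to_poly_in_orth_polys by blast
qed

text \<open>
  Symmetrized products of basis vectors span the symmetric tensors, so a linear map with the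
  prescribed values on symmetrized products is unique.
\<close>

lemma U_map_eq: "U_map \<mu> n = restrict (tensor_to_poly n) (sym_tensors n)"
  unfolding U_map_def
proof (rule the_equality, goal_cases)
  case 1
  show ?case
  proof (intro conjI allI impI)
    show "linear_on tensor_scale poly_scale (sym_tensors n)
        (restrict (tensor_to_poly n) (sym_tensors n))"
      by (simp add: linear_on_def sym_tensors_add sym_tensors_scale tensor_to_poly_add
          tensor_to_poly_scale)
    show "bij_betw (restrict (tensor_to_poly n) (sym_tensors n)) (sym_tensors n) (orth_polys \<mu> n)"
      using bij_tensor_to_poly[of n] by (rule bij_betw_cong[THEN iffD1, rotated]) simp
    show "restrict (tensor_to_poly n) (sym_tensors n) (sym_prod vs) = foldr (creation \<mu>) vs 1"
      if "length vs = n" for vs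
      using that sym_prod_sym[OF that] tensor_to_poly_sym_prod[of vs]
      by (simp add: iterated_creation)
  qed simp
next
  case (2 U)
  show ?case
  proof (rule extensionalityI[where A = "sym_tensors n"])
    fix T :: "'d tensor" assume T: "T \<in> sym_tensors n"
    have "U T = U (\<Sum>i | length i = n. tensor_scale (T i) (sym_prod (basis_vectors i)))"
      using sym_tensor_expansion[OF T] by simp
    also have "\<dots> = (\<Sum>i | length i = n. U (tensor_scale (T i) (sym_prod (basis_vectors i))))"
      using 2 by (intro linear_on_sum[where s = poly_scale])
        (auto intro!: sym_tensors_scale sym_prod_sym)
    also have "\<dots> = (\<Sum>i | length i = n. poly_scale (T i) (Q (exponent i)))"
    proof (intro sum.cong refl)
      fix i :: "'d list" assume "i \<in> {i. length i = n}"
      then have "sym_prod (basis_vectors i) \<in> sym_tensors n"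
        and "U (sym_prod (basis_vectors i)) = Q (exponent i)"
        using 2 sym_prod_sym[of "basis_vectors i" n] iterated_creation_basis[of i] by auto
      then show "U (tensor_scale (T i) (sym_prod (basis_vectors i))) = poly_scale (T i) (Q (exponent i))"
        using 2 by (simp add: linear_on_def)
    qed
    finally show "U T = restrict (tensor_to_poly n) (sym_tensors n) T"
      using T by (simp add: tensor_to_poly_def)
  qed (use 2 in simp_all)
qed

text \<open>
  The pullback of the zero operator sends every tensor to the preimage of zero, which is zero by
  injectivity.
\<close>

lemma Jacobi_alpha_eq_0:
  assumes T: "T \<in> sym_tensors n"
  shows "Jacobi_alpha \<mu> v n T = 0"
proof -
  have U0: "U_map \<mu> n 0 = 0"
    by (simp add: U_map_eq sym_tensors_0 tensor_to_poly_def)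
  have "preservation \<mu> v n (U_map \<mu> n T) = 0"
    using T by (simp add: U_map_eq preservation_eq_0 tensor_to_poly_in_orth_polys)
  moreover have "inj_on (U_map \<mu> n) (sym_tensors n)"
    using bij_betw_imp_inj_on[OF bij_tensor_to_poly[of n]] by (simp add: U_map_eq)
  ultimately show ?thesis
    using T U0 inv_into_f_f[of "U_map \<mu> n" "sym_tensors n" 0] sym_tensors_0[of n]
    by (simp add: Jacobi_alpha_def)
qed

lemma pip_tensor_to_poly:
  assumes "\<eta> \<in> sym_tensors n"
  shows "pip \<mu> (tensor_to_poly n \<xi>) (tensor_to_poly n \<eta>) =
    tensor_ip n \<xi> (\<lambda>i. complex_of_real (rearrangements (exponent i) * h (exponent i)) * \<eta> i)"
  unfolding tensor_to_poly_def[of n \<xi>] tensor_ip_def pip_sum_left pip_scale_left pip_Q_left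
  by (intro sum.cong refl) (simp add: coef_tensor_to_poly[OF assms] mult_ac)

text \<open>
  In coordinates \<open>\<Omega>\<^sub>n\<close> multiplies by a function of the exponent vector. This operator satisfies the
  description, and by nondegeneracy it is the only one that does, so the defining equation is
  available.
\<close>

lemma tensor_ip_Jacobi_Omega:
  assumes "\<xi> \<in> sym_tensors n" "\<eta> \<in> sym_tensors n"
  shows "tensor_ip n \<xi> (Jacobi_Omega \<mu> n \<eta>) = pip \<mu> (U_map \<mu> n \<xi>) (U_map \<mu> n \<eta>)"
proof -
  let ?P = "\<lambda>W. W \<in> sym_tensors n \<rightarrow>\<^sub>E sym_tensors n \<and>
    linear_on tensor_scale tensor_scale (sym_tensors n) W \<and>
    (\<forall>\<xi>\<in>sym_tensors n. \<forall>\<eta>\<in>sym_tensors n.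
       tensor_ip n \<xi> (W \<eta>) = pip \<mu> (U_map \<mu> n \<xi>) (U_map \<mu> n \<eta>))"
  \<comment> \<open>On a class of index lists the sum of the coordinates carries a multinomial factor, while the
    tensor scalar product counts each list separately; \<open>W\<close> makes up for it.\<close>
  define W where "W = restrict (\<lambda>\<eta> i. complex_of_real (rearrangements (exponent i) * h (exponent i)) * \<eta> i)
    (sym_tensors n)"
  have "?P W"
  proof (intro conjI ballI)
    show "W \<in> sym_tensors n \<rightarrow>\<^sub>E sym_tensors n"
    proof (rule PiE_I)
      fix \<eta> :: "'d tensor" assume \<eta>: "\<eta> \<in> sym_tensors n"
      have "(\<lambda>i. complex_of_real (rearrangements (exponent i) * h (exponent i)) * \<eta> i) \<in> sym_tensors n"
        using \<eta> unfolding sym_tensors_def by (auto simp: exponent_permute_list)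
      then show "W \<eta> \<in> sym_tensors n"
        using \<eta> by (simp add: W_def)
    qed (simp add: W_def)
    show "linear_on tensor_scale tensor_scale (sym_tensors n) W"
      unfolding linear_on_def
      by (simp add: W_def sym_tensors_add sym_tensors_scale fun_eq_iff distrib_left)
        (simp add: tensor_scale_def mult_ac)
    show "tensor_ip n \<xi> (W \<eta>) = pip \<mu> (U_map \<mu> n \<xi>) (U_map \<mu> n \<eta>)"
      if "\<xi> \<in> sym_tensors n" "\<eta> \<in> sym_tensors n" for \<xi> \<eta>
      using that by (simp add: W_def U_map_eq pip_tensor_to_poly)
  qed
  moreover have "V = W" if V: "?P V" for V
  proof (rule extensionalityI[where A = "sym_tensors n"])
    fix \<eta> :: "'d tensor" assume \<eta>: "\<eta> \<in> sym_tensors n"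
    show "V \<eta> = W \<eta>"
      using V \<open>?P W\<close> \<eta> by (intro tensor_ip_nondegenerate[where n = n]) (auto simp: PiE_iff)
  qed (use V \<open>?P W\<close> in \<open>auto simp: PiE_iff\<close>)
  ultimately have "?P (Jacobi_Omega \<mu> n)"
    unfolding Jacobi_Omega_def by (rule theI)
  then show ?thesis using assms by blast
qed

text \<open>
  Under \<open>U\<^sub>n\<close> the symmetrized basis tensors become the members of the family themselves, so the
  coefficients of \<open>\<Omega>\<^sub>n\<close> are their mutual inner products.
\<close>

lemma Omega_coeff_eq:
  assumes "length i = n" "length j = n"
  shows "Omega_coeff \<mu> n (tuple_class n i) (tuple_class n j) =
    complex_of_real (of_bool (tuple_class n i = tuple_class n j) * h (exponent i))"
proof -
  have U: "U_map \<mu> n (sym_prod (basis_vectors k)) = Q (exponent k)"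
    if "length k = n" for k
    using that sym_prod_sym[of "basis_vectors k" n] tensor_to_poly_sym_prod[of "basis_vectors k"]
      iterated_creation_basis[of k] iterated_creation[of "basis_vectors k"]
    by (simp add: U_map_eq)
  have "Omega_coeff \<mu> n (tuple_class n i) (tuple_class n j) = pip \<mu> (Q (exponent i)) (Q (exponent j))"
    using assms by (simp add: Omega_coeff_def e_class_tuple_class tensor_ip_Jacobi_Omega sym_prod_sym U)
  then show ?thesis
    using assms by (simp add: pip_Q tuple_class_eq_iff)
qed

end


section \<open>Monic Gegenbauer polynomials on the interval\<close>

text \<open>
  The general formula at index \<open>k\<close> is \<open>k (k + 2 l - 1) / (4 (k + l) (k + l - 1))\<close>. At \<open>k = 1\<close> the
  factor \<open>2 l / l\<close> is cancelled, which keeps the value right for \<open>l = 0\<close> (Chebyshev polynomials of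
  the first kind); at \<open>k = 0\<close> there is no lower polynomial.
\<close>

fun gegenbauer_coef :: "real \<Rightarrow> nat \<Rightarrow> real" where
  "gegenbauer_coef l 0 = 0"
| "gegenbauer_coef l (Suc 0) = 1 / (2 * (1 + l))"
| "gegenbauer_coef l (Suc (Suc k)) =
     (real k + 2) * (real k + 2 * l + 1) / (4 * (real k + 2 + l) * (real k + 1 + l))"

text \<open>
  The Gegenbauer polynomials with leading coefficient one.
\<close>

fun gegenbauer_poly :: "real \<Rightarrow> nat \<Rightarrow> real poly" where
  "gegenbauer_poly l 0 = 1"
| "gegenbauer_poly l (Suc 0) = [:0, 1:]"
| "gegenbauer_poly l (Suc (Suc k)) =
     [:0, 1:] * gegenbauer_poly l (Suc k) - smult (gegenbauer_coef l (Suc k)) (gegenbauer_poly l k)"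

definition gegenbauer_weight :: "real \<Rightarrow> real \<Rightarrow> real" where
  "gegenbauer_weight l x = indicator {-1..1} x * (1 - x\<^sup>2) powr (l - 1/2)"

definition gegenbauer_integral :: "real \<Rightarrow> real poly \<Rightarrow> real" where
  "gegenbauer_integral l p = (\<integral>x. gegenbauer_weight l x * poly p x \<partial>lborel)"

text \<open>
  The squared norm of the polynomial of index \<open>k\<close>: the total mass of the weight times the first
  \<open>k\<close> recurrence coefficients, as for any monic orthogonal polynomials.
\<close>

definition gegenbauer_norm :: "real \<Rightarrow> nat \<Rightarrow> real" where
  "gegenbauer_norm l k =
     2 powr (2 * l) * (Gamma (l + 1/2))\<^sup>2 / Gamma (2 * l + 1) * (\<Prod>i<k. gegenbauer_coef l (Suc i))"

lemma gegenbauer_poly_recurrence: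
  "[:0, 1:] * gegenbauer_poly l k =
     gegenbauer_poly l (Suc k) + smult (gegenbauer_coef l k) (gegenbauer_poly l (k - 1))"
  by (cases k) simp_all

lemma poly_gegenbauer_recurrence:
  "x * poly (gegenbauer_poly l k) x =
     poly (gegenbauer_poly l (Suc k)) x + gegenbauer_coef l k * poly (gegenbauer_poly l (k - 1)) x"
  using arg_cong[OF gegenbauer_poly_recurrence[of l k], of "\<lambda>p. poly p x"] by simp

lemma gegenbauer_weight_nonneg: "gegenbauer_weight l x \<ge> 0"
  by (simp add: gegenbauer_weight_def)

lemma gegenbauer_weight_measurable [measurable]: "gegenbauer_weight l \<in> borel_measurable borel"
  unfolding gegenbauer_weight_def[abs_def] by measurable

context
  fixes l :: real
  assumes l: "l > - (1/2)"
begin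

lemma gegenbauer_coef_pos: "gegenbauer_coef l (Suc k) > 0"
  using l by (cases k) (auto intro!: divide_pos_pos mult_pos_pos)

lemma gegenbauer_norm_pos: "gegenbauer_norm l k > 0"
proof -
  have "Gamma (l + 1/2) > 0" "Gamma (2 * l + 1) > 0"
    using l by (auto intro!: Gamma_real_pos)
  then show ?thesis
    unfolding gegenbauer_norm_def
    by (intro mult_pos_pos divide_pos_pos prod_pos zero_less_power) (simp_all add: gegenbauer_coef_pos)
qed

text \<open>
  The comparison of coefficients to which the induction step for the structure relation reduces.
\<close>

lemma gegenbauer_coef_step:
  "1 + 2 * (real k + l) * gegenbauer_coef l (Suc k) =
     2 * (real k + 2 + l) * gegenbauer_coef l (Suc (Suc k))"
proof (cases k)
  case 0
  have "1 + l \<noteq> 0" "2 + l \<noteq> 0" using l by auto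
  then have "1 + 2 * l * (1 / (2 * (1 + l))) = 2 * (2 + l) * (2 * (2 * l + 1) / (4 * (2 + l) * (1 + l)))"
    by (simp add: divide_simps) algebra
  then show ?thesis using 0 by simp
next
  case (Suc i)
  have "real i + 1 + l > 0" "real i + 2 + l > 0" "real i + 3 + l > 0" using l by auto
  then have nz: "real i + 1 + l \<noteq> 0" "real i + 2 + l \<noteq> 0" "real i + 3 + l \<noteq> 0" by auto
  have "1 + 2 * (real i + 1 + l) * ((real i + 2) * (real i + 2 * l + 1) /
        (4 * (real i + 2 + l) * (real i + 1 + l))) =
      2 * (real i + 3 + l) * ((real i + 3) * (real i + 2 * l + 2) /
        (4 * (real i + 3 + l) * (real i + 2 + l)))"
    using nz by (simp add: divide_simps) algebra
  then show ?thesis using Suc by (simp add: add_ac)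
qed

text \<open>
  Differentiation followed by multiplication with \<open>1 - x\<^sup>2\<close> is expressed by the polynomials of the
  same parameter. Two steps of the three-term recurrence and its derivative give the induction step.
\<close>

lemma gegenbauer_structure_relation:
  "(1 - x\<^sup>2) * poly (pderiv (gegenbauer_poly l n)) x =
     - real n * x * poly (gegenbauer_poly l n) x +
     2 * (real n + l) * gegenbauer_coef l n * poly (gegenbauer_poly l (n - 1)) x"
proof (induction n rule: less_induct)
  case (less n)
  consider "n = 0" | "n = 1" | k where "n = Suc (Suc k)"
    by (metis One_nat_def not0_implies_Suc)
  then show ?case
  proof cases
    case 1
    then show ?thesis by simp
  next
    case 2
    have "1 + l \<noteq> 0" using l by auto
    then show ?thesis using 2 by (simp add: pderiv_pCons power2_eq_square field_simps)
  next
    case (3 k)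
    define w where "w = gegenbauer_coef l"
    define p where "p = (\<lambda>n. poly (gegenbauer_poly l n) x)"
    define p' where "p' = (\<lambda>n. poly (pderiv (gegenbauer_poly l n)) x)"
    have A: "(1 - x\<^sup>2) * p' (Suc k) =
        - (real k + 1) * x * p (Suc k) + 2 * (real k + 1 + l) * w (Suc k) * p k"
      using less[of "Suc k"] 3 by (simp add: p_def p'_def w_def add_ac)
    have B: "(1 - x\<^sup>2) * p' k = - real k * x * p k + 2 * (real k + l) * w k * p (k - 1)"
      using less[of k] 3 by (simp add: p_def p'_def w_def)
    have C: "w k * p (k - 1) = x * p k - p (Suc k)"
      using poly_gegenbauer_recurrence[of x l k] by (simp add: p_def w_def)
    have D: "p (Suc (Suc k)) = x * p (Suc k) - w (Suc k) * p k"
      by (simp add: p_def w_def)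
    have E: "p' (Suc (Suc k)) = p (Suc k) + x * p' (Suc k) - w (Suc k) * p' k"
      by (simp add: p_def p'_def w_def pderiv_diff pderiv_mult pderiv_smult pderiv_pCons)
    have F: "2 * (real k + 2 + l) * w (Suc (Suc k)) = 1 + 2 * (real k + l) * w (Suc k)"
      using gegenbauer_coef_step[of k] by (simp add: w_def)
    have B': "(1 - x\<^sup>2) * p' k = - real k * x * p k + 2 * (real k + l) * (x * p k - p (Suc k))"
      using B C by (simp add: mult.assoc)
    have "(1 - x\<^sup>2) * p' (Suc (Suc k)) =
        (1 - x\<^sup>2) * p (Suc k) + x * ((1 - x\<^sup>2) * p' (Suc k)) - w (Suc k) * ((1 - x\<^sup>2) * p' k)"
      unfolding E by (simp add: algebra_simps)
    also have "\<dots> = - (real k + 2) * x * p (Suc (Suc k)) +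
        2 * (real k + 2 + l) * w (Suc (Suc k)) * p (Suc k)"
      unfolding A B' D F by (simp add: algebra_simps power2_eq_square)
    finally show ?thesis
      by (simp add: 3 p_def p'_def w_def algebra_simps
          del: gegenbauer_poly.simps gegenbauer_coef.simps)
  qed
qed

text \<open>
  The substitution \<open>x = 2 t - 1\<close> turns \<open>1 - x\<^sup>2\<close> into \<open>4 t (1 - t)\<close> and the total mass into a Beta
  integral with two equal arguments.
\<close>

lemma has_bochner_integral_gegenbauer_weight:
  "has_bochner_integral lborel (gegenbauer_weight l)
     (2 powr (2 * l) * (Gamma (l + 1/2))\<^sup>2 / Gamma (2 * l + 1))"
proof -
  let ?a = "l + 1/2"
  let ?f = "\<lambda>t. t powr (l - 1/2) * (1 - t) powr (l - 1/2)"
  have B: "(?f has_integral Beta ?a ?a) {0..1}"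
    using has_integral_Beta_real[of ?a ?a] l by simp
  have Bnn: "Beta ?a ?a \<ge> 0"
    using has_integral_nonneg[OF B] by simp
  have "(\<integral>\<^sup>+t. ennreal (indicator {0..1} t * ?f t) \<partial>lborel) = ennreal (Beta ?a ?a)"
  proof (rule nn_integral_has_integral_lborel)
    have "(\<lambda>t. indicator {0..1} t * ?f t) = (\<lambda>t. if t \<in> {0..1} then ?f t else 0)"
      by (auto simp: indicator_def)
    then show "((\<lambda>t. indicator {0..1} t * ?f t) has_integral Beta ?a ?a) UNIV"
      using B by (simp only: has_integral_restrict_UNIV)
  qed simp_all
  then have "has_bochner_integral lborel (\<lambda>t. indicator {0..1} t * ?f t) (Beta ?a ?a)"
    using Bnn by (intro has_bochner_integral_nn_integral) simp_all
  then have "has_bochner_integral lborel (\<lambda>t. 4 powr (l - 1/2) * (indicator {0..1} t * ?f t))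
      (4 powr (l - 1/2) * Beta ?a ?a)"
    by (rule has_bochner_integral_mult_right)
  moreover have "gegenbauer_weight l (-1 + 2 * t) = 4 powr (l - 1/2) * (indicator {0..1} t * ?f t)"
    for t
  proof (cases "t \<in> {0..1}")
    case True
    have "1 - (-1 + 2 * t)\<^sup>2 = 4 * (t * (1 - t))"
      by (simp add: power2_eq_square algebra_simps)
    then show ?thesis
      using True by (simp add: gegenbauer_weight_def powr_mult)
  qed (auto simp: gegenbauer_weight_def indicator_def)
  ultimately have "has_bochner_integral lborel (\<lambda>t. gegenbauer_weight l (-1 + 2 * t))
      (4 powr (l - 1/2) * Beta ?a ?a)"
    by simp
  then have "has_bochner_integral lborel (\<lambda>t. gegenbauer_weight l (-1 + 2 * t))
      ((2 * 4 powr (l - 1/2) * Beta ?a ?a) /\<^sub>R \<bar>2\<bar>)"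
    by simp
  then have "has_bochner_integral lborel (gegenbauer_weight l) (2 * 4 powr (l - 1/2) * Beta ?a ?a)"
    by (subst lborel_has_bochner_integral_real_affine_iff[where c = 2 and t = "-1"]) simp_all
  moreover have "2 * 4 powr (l - 1/2) = 2 powr (2 * l)"
  proof -
    have "4 powr (l - 1/2) = (2 powr 2) powr (l - 1/2)" by simp
    also have "\<dots> = 2 powr (2 * l - 1)"
      unfolding powr_powr by (simp add: algebra_simps)
    finally show ?thesis by (simp add: powr_diff)
  qed
  moreover have "Beta ?a ?a = (Gamma ?a)\<^sup>2 / Gamma (2 * l + 1)"
    by (simp add: Beta_def power2_eq_square algebra_simps)
  ultimately show ?thesis by (simp add: mult.assoc)
qed

lemma integrable_gegenbauer_weight: "integrable lborel (gegenbauer_weight l)"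
  using has_bochner_integral_gegenbauer_weight by (rule integrable.intros)

lemma integrable_gegenbauer_weight_poly:
  "integrable lborel (\<lambda>x. gegenbauer_weight l x * poly p x)"
proof -
  have "bounded (poly p ` {-1..1})"
    by (intro compact_imp_bounded compact_continuous_image continuous_intros) simp
  then have "\<exists>C. \<forall>x\<in>{-1..1}. \<bar>poly p x\<bar> \<le> C"
    by (auto simp: bounded_iff)
  then obtain C where C: "\<And>x. x \<in> {-1..1} \<Longrightarrow> \<bar>poly p x\<bar> \<le> C"
    by blast
  have [measurable]: "poly p \<in> borel_measurable borel"
    by (intro borel_measurable_continuous_onI continuous_intros)
  show ?thesis
  proof (rule Bochner_Integration.integrable_bound[of _ "\<lambda>x. C * gegenbauer_weight l x"])
    show "AE x in lborel. norm (gegenbauer_weight l x * poly p x) \<le> norm (C * gegenbauer_weight l x)"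
    proof (intro AE_I2)
      fix x
      show "norm (gegenbauer_weight l x * poly p x) \<le> norm (C * gegenbauer_weight l x)"
      proof (cases "x \<in> {-1..1}")
        case True
        then show ?thesis
          using mult_right_mono[OF order_trans[OF C[OF True] abs_ge_self] gegenbauer_weight_nonneg[of l x]]
          by (simp add: abs_mult gegenbauer_weight_nonneg mult.commute)
      qed (simp add: gegenbauer_weight_def)
    qed
  qed (auto intro: integrable_gegenbauer_weight)
qed

lemma gegenbauer_integral_linear:
  "gegenbauer_integral l (p + q) = gegenbauer_integral l p + gegenbauer_integral l q"
  "gegenbauer_integral l (p - q) = gegenbauer_integral l p - gegenbauer_integral l q"
  "gegenbauer_integral l (smult c p) = c * gegenbauer_integral l p"
  using integrable_gegenbauer_weight_poly
  by (simp_all add: gegenbauer_integral_def distrib_left right_diff_distrib mult.left_commute)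

text \<open>
  The integrand is the derivative of \<open>(1 - x\<^sup>2) powr (l + 1/2)\<close> times \<open>f\<close>, which vanishes at both end
  points because the exponent is positive.
\<close>

lemma gegenbauer_integral_by_parts:
  "gegenbauer_integral l ([:1, 0, -1:] * pderiv f - smult (2 * l + 1) ([:0, 1:] * f)) = 0"
    (is "gegenbauer_integral l ?g = 0")
proof -
  let ?F = "\<lambda>x. (1 - x\<^sup>2) powr (l + 1/2) * poly f x"
  let ?F' = "\<lambda>x. (1 - x\<^sup>2) powr (l - 1/2) * poly ?g x"
  have le: "x\<^sup>2 \<le> 1" if "x \<in> {-1..1}" for x :: real
    using that by (simp add: abs_square_le_1 abs_le_iff)
  have "(?F' has_integral (?F 1 - ?F (-1))) {-1..1}"
  proof (rule fundamental_theorem_of_calculus_interior)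
    show "continuous_on {-1..1} ?F"
      using l le by (intro continuous_intros continuous_on_powr') (auto simp: field_simps)
    show "(?F has_vector_derivative ?F' x) (at x)" if "x \<in> {-1<..<1}" for x
    proof -
      have pos: "1 - x\<^sup>2 > 0"
        using that by (simp add: abs_square_less_1 abs_less_iff)
      have "((\<lambda>x. (1 - x\<^sup>2) powr (l + 1/2)) has_real_derivative
          (l + 1/2) * (1 - x\<^sup>2) powr (l + 1/2 - 1) * (- (2 * x))) (at x)"
        using pos by (auto intro!: derivative_eq_intros)
      then have D: "(?F has_real_derivative
          (l + 1/2) * (1 - x\<^sup>2) powr (l + 1/2 - 1) * (- (2 * x)) * poly f x +
          poly (pderiv f) x * (1 - x\<^sup>2) powr (l + 1/2)) (at x)"
        by (rule DERIV_mult) (rule poly_DERIV)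
      have "(1 - x\<^sup>2) powr (l + 1/2) = (1 - x\<^sup>2) * (1 - x\<^sup>2) powr (l - 1/2)"
        using pos powr_add[of "1 - x\<^sup>2" 1 "l - 1/2"] by (simp add: add.commute)
      then have "(l + 1/2) * (1 - x\<^sup>2) powr (l + 1/2 - 1) * (- (2 * x)) * poly f x +
          poly (pderiv f) x * (1 - x\<^sup>2) powr (l + 1/2) =
          (l + 1/2) * (1 - x\<^sup>2) powr (l - 1/2) * (- (2 * x)) * poly f x +
          poly (pderiv f) x * ((1 - x\<^sup>2) * (1 - x\<^sup>2) powr (l - 1/2))"
        by simp
      also have "\<dots> = ?F' x"
        by (simp add: algebra_simps power2_eq_square)
      finally have "(?F has_real_derivative ?F' x) (at x)"
        by (rule DERIV_cong[rotated]) (rule D)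
      then show ?thesis
        by (simp add: has_real_derivative_iff_has_vector_derivative)
    qed
  qed simp
  then have "(?F' has_integral 0) {-1..1}"
    by simp
  moreover have "(\<lambda>x. gegenbauer_weight l x * poly ?g x) = (\<lambda>x. if x \<in> {-1..1} then ?F' x else 0)"
    by (rule ext) (simp add: gegenbauer_weight_def indicator_def)
  ultimately have "((\<lambda>x. gegenbauer_weight l x * poly ?g x) has_integral 0) UNIV"
    by (simp only: has_integral_restrict_UNIV)
  moreover have "((\<lambda>x. gegenbauer_weight l x * poly ?g x) has_integral gegenbauer_integral l ?g) UNIV"
    unfolding gegenbauer_integral_def
    by (rule has_integral_integral_lborel[OF integrable_gegenbauer_weight_poly])
  ultimately show ?thesis
    using has_integral_unique by blast
qed

text \<open>
  Integration by parts is applied to the polynomial of index \<open>n\<close>. By the structure relation and the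
  recurrence, the polynomial integrated there is a combination of the polynomials of index \<open>n + 1\<close> and
  \<open>n - 1\<close>; the first has a nonzero coefficient, and the second integrates to zero by induction or
  has coefficient zero.
\<close>

lemma gegenbauer_integral_poly_eq_0: "gegenbauer_integral l (gegenbauer_poly l (Suc n)) = 0"
proof (induction n rule: less_induct)
  case (less n)
  let ?p = "gegenbauer_poly l" and ?w = "gegenbauer_coef l" and ?L = "gegenbauer_integral l"
  have "[:1, 0, -1:] * pderiv (?p n) - smult (2 * l + 1) ([:0, 1:] * ?p n) =
      smult (- (real n + 2 * l + 1)) (?p (Suc n)) + smult ((real n - 1) * ?w n) (?p (n - 1))"
  proof (rule poly_eq_poly_eq_iff[THEN iffD1], rule ext)
    fix x
    have "poly ([:1, 0, -1:] * pderiv (?p n) - smult (2 * l + 1) ([:0, 1:] * ?p n)) x =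
        (1 - x\<^sup>2) * poly (pderiv (?p n)) x - (2 * l + 1) * (x * poly (?p n) x)"
      by (simp add: power2_eq_square algebra_simps)
    also have "\<dots> = - (real n + 2 * l + 1) * (x * poly (?p n) x) +
        2 * (real n + l) * ?w n * poly (?p (n - 1)) x"
      unfolding gegenbauer_structure_relation by (simp add: algebra_simps)
    also have "\<dots> = - (real n + 2 * l + 1) * poly (?p (Suc n)) x +
        (real n - 1) * ?w n * poly (?p (n - 1)) x"
      unfolding poly_gegenbauer_recurrence by (simp add: algebra_simps)
    finally show "poly ([:1, 0, -1:] * pderiv (?p n) - smult (2 * l + 1) ([:0, 1:] * ?p n)) x =
        poly (smult (- (real n + 2 * l + 1)) (?p (Suc n)) + smult ((real n - 1) * ?w n) (?p (n - 1))) x"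
      by simp
  qed
  then have "- (real n + 2 * l + 1) * ?L (?p (Suc n)) + (real n - 1) * ?w n * ?L (?p (n - 1)) = 0"
    using gegenbauer_integral_by_parts[of "?p n"] by (simp only: gegenbauer_integral_linear)
  moreover have "(real n - 1) * ?w n * ?L (?p (n - 1)) = 0"
  proof -
    consider "n = 0" | "n = 1" | k where "n = Suc (Suc k)"
      by (metis One_nat_def not0_implies_Suc)
    then show ?thesis
      using less[of "n - 2"] by cases auto
  qed
  moreover have "real n + 2 * l + 1 > 0"
    using l by auto
  ultimately have "(real n + 2 * l + 1) * ?L (?p (Suc n)) = 0"
    by linarith
  with \<open>real n + 2 * l + 1 > 0\<close> show ?case by simp
qed

text \<open>
  Multiplication by \<open>x\<close> is symmetric for the integral, so the recurrence can be moved from one factor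
  to the other until one index is zero. Then only the vanishing integrals of the polynomials of
  positive index and the total mass are left.
\<close>

lemma gegenbauer_orthogonality:
  "gegenbauer_integral l (gegenbauer_poly l k * gegenbauer_poly l m) =
     (if k = m then gegenbauer_norm l k else 0)"
proof (induction k arbitrary: m rule: less_induct)
  case (less k)
  let ?p = "gegenbauer_poly l" and ?w = "gegenbauer_coef l" and ?L = "gegenbauer_integral l"
  show ?case
  proof (cases k)
    case 0
    have "?L 1 = gegenbauer_norm l 0"
      using has_bochner_integral_integral_eq[OF has_bochner_integral_gegenbauer_weight]
      by (simp add: gegenbauer_integral_def gegenbauer_norm_def)
    then show ?thesis
      using 0 gegenbauer_integral_poly_eq_0 by (cases m) simp_all
  next
    case (Suc i)
    \<comment> \<open>The variable \<open>x\<close> in the recurrence for the left factor is moved to the right one.\<close>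
    have "?p (Suc i) * ?p m = ?p i * ?p (Suc m) + smult (?w m) (?p i * ?p (m - 1))
        - smult (?w i) (?p (i - 1) * ?p m)"
    proof -
      have 1: "?p (Suc i) = [:0, 1:] * ?p i - smult (?w i) (?p (i - 1))"
        and 2: "[:0, 1:] * ?p m = ?p (Suc m) + smult (?w m) (?p (m - 1))"
        using gegenbauer_poly_recurrence[of l i] gegenbauer_poly_recurrence[of l m] by simp_all
      have "?p (Suc i) * ?p m = ?p i * ([:0, 1:] * ?p m) - smult (?w i) (?p (i - 1) * ?p m)"
      proof -
        have "(X * a - smult c b) * d = a * (X * d) - smult c (b * d)" for X a b d :: "real poly" and c
          by (simp add: algebra_simps)
        then show ?thesis unfolding 1 .
      qed
      then show ?thesis unfolding 2 by (simp only: distrib_left mult_smult_right)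
    qed
    then have "?L (?p (Suc i) * ?p m) = ?L (?p i * ?p (Suc m)) + ?w m * ?L (?p i * ?p (m - 1))
        - ?w i * ?L (?p (i - 1) * ?p m)"
      by (simp only: gegenbauer_integral_linear)
    also have "?L (?p i * ?p (Suc m)) = (if i = Suc m then gegenbauer_norm l i else 0)"
      using less Suc by blast
    also have "?w m * ?L (?p i * ?p (m - 1)) = (if Suc i = m then gegenbauer_norm l (Suc i) else 0)"
      using less[of i "m - 1"] Suc by (cases m) (auto simp: gegenbauer_norm_def)
    also have "?w i * ?L (?p (i - 1) * ?p m) = (if i = Suc m then gegenbauer_norm l i else 0)"
      using less[of "i - 1" m] Suc by (cases i) (auto simp: gegenbauer_norm_def)
    finally show ?thesis using Suc by simp
  qed
qed

end


section \<open>The closed form of the norms, and integrals of separated variables\<close>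

lemma ext0_isCont: "isCont f 0 \<Longrightarrow> ext0 f t = f t"
  by (simp add: ext0_def isCont_def tendsto_Lim)

lemma ext0_removable:
  assumes "isCont g 0" and eq: "\<And>t. t \<noteq> 0 \<Longrightarrow> t > - (1/2) \<Longrightarrow> f t = g t" and "t > - (1/2)"
  shows "ext0 f t = g t"
proof -
  have "eventually (\<lambda>t. f t = g t) (at 0)"
    unfolding eventually_at
  proof (intro exI[of _ "1/2"] conjI ballI impI)
    fix t :: real assume "t \<noteq> 0 \<and> dist t 0 < 1/2"
    then show "f t = g t"
      by (intro eq) (auto simp: dist_real_def)
  qed simp
  then have "(f \<longlongrightarrow> g 0) (at 0)"
    using assms(1) tendsto_cong[of f g "at 0" "g 0"] by (simp add: isCont_def)
  then show ?thesis
    using eq assms(3) by (simp add: ext0_def tendsto_Lim)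
qed

context
  fixes l :: real
  assumes l: "l > - (1/2)"
begin

text \<open>
  For \<open>p = 0\<close> the factor \<open>t\<close> cancels; otherwise the function is continuous at zero.
\<close>

lemma ext0_inner_factor:
  "ext0 (\<lambda>t. (real p + 1) * (2 * t + real p) / ((real p + t) * (2 * real p + 2 * t + 1))) l =
     (if p = 0 then 2 / (2 * l + 1)
      else (real p + 1) * (2 * l + real p) / ((real p + l) * (2 * real p + 2 * l + 1)))"
proof (cases "p = 0")
  case True
  have "ext0 (\<lambda>t. 2 * t / (t * (2 * t + 1))) l = 2 / (2 * l + 1)"
    using l by (intro ext0_removable) (auto intro!: continuous_intros)
  then show ?thesis using True by simp
next
  case False
  then show ?thesis
    by (subst ext0_isCont) (auto intro!: continuous_intros simp: add_eq_0_iff)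
qed

text \<open>
  For \<open>n = 0\<close> the functional equation of the Gamma function removes the pole.
\<close>

lemma ext0_denominator:
  "ext0 (\<lambda>t. (2 * real n + 2 * t) * Gamma (real n + 2 * t)) l =
     (if n = 0 then Gamma (2 * l + 1) else (2 * real n + 2 * l) * Gamma (real n + 2 * l))"
proof (cases "n = 0")
  case True
  have "ext0 (\<lambda>t. 2 * t * Gamma (2 * t)) l = Gamma (2 * l + 1)"
  proof (rule ext0_removable[where g = "\<lambda>t. Gamma (2 * t + 1)"])
    show "isCont (\<lambda>t. Gamma (2 * t + 1)) (0::real)"
      by (intro continuous_intros) auto
  next
    fix t :: real assume t: "t \<noteq> 0" "t > - (1/2)"
    have "2 * t \<notin> \<int>\<^sub>\<le>\<^sub>0"
    proof
      assume "2 * t \<in> \<int>\<^sub>\<le>\<^sub>0"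
      then obtain k :: nat where "2 * t = - real k"
        by (auto elim!: nonpos_Ints_cases')
      then show False using t by (cases k) auto
    qed
    then show "2 * t * Gamma (2 * t) = Gamma (2 * t + 1)"
      by (simp add: Gamma_plus1)
  qed (use l in auto)
  then show ?thesis using True by simp
next
  case False
  then have "real n + 2 * 0 \<notin> \<int>\<^sub>\<le>\<^sub>0"
    by (auto elim!: nonpos_Ints_cases')
  then show ?thesis
    using False by (subst ext0_isCont) (auto intro!: continuous_intros)
qed

text \<open>
  Both sides agree at \<open>n = 0\<close> and have the same quotients of consecutive terms, namely the recurrence
  coefficients; on the right they come from \<open>Gamma (x + 1) = x * Gamma x\<close>.
\<close>

lemma gegenbauer_norm_closed_form:
  "gegenbauer_norm l n =
    2 powr (2 * l) / fact n *
    (\<Prod>p<n. ext0 (\<lambda>t. (real p + 1) * (2 * t + real p) / ((real p + t) * (2 * real p + 2 * t + 1))) l)\<^sup>2 *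
    ((Gamma (real n + l + 1/2))\<^sup>2 /
      ext0 (\<lambda>t. (2 * real n + 2 * t) * Gamma (real n + 2 * t)) l)"
proof -
  define c where "c = (\<lambda>p. ext0 (\<lambda>t. (real p + 1) * (2 * t + real p) /
    ((real p + t) * (2 * real p + 2 * t + 1))) l)"
  define E where "E = (\<lambda>n. ext0 (\<lambda>t. (2 * real n + 2 * t) * Gamma (real n + 2 * t)) l)"
  have E_pos: "E n > 0" for n
    using l by (auto simp: E_def ext0_denominator intro!: mult_pos_pos Gamma_real_pos)
  \<comment> \<open>The quotient of consecutive terms, in a form without division; index zero is special because the
    factors there are the continuous extensions.\<close>
  have ratio: "(c n)\<^sup>2 * (real n + l + 1/2)\<^sup>2 * E n =
      (real n + 1) * E (Suc n) * gegenbauer_coef l (Suc n)" for n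
  proof (cases n)
    case 0
    have "E 1 = (2 + 2 * l) * E 0"
      using ext0_denominator[of 0] ext0_denominator[of 1] by (simp add: E_def add.commute)
    moreover have "c 0 = 2 / (2 * l + 1)"
      unfolding c_def ext0_inner_factor by simp
    then have "c 0 * (l + 1/2) = 1"
      using l by (simp add: field_simps)
    then have "(c 0)\<^sup>2 * (l + 1/2)\<^sup>2 = 1"
      by (metis power_mult_distrib power_one)
    ultimately show ?thesis
      using 0 l by simp
  next
    case (Suc k)
    have pos: "real n + l > 0" "real n + 2 * l > 0" "real n + 1 + l > 0" "2 * real n + 2 * l + 1 > 0"
      using l Suc by auto
    have "real n + 2 * l \<notin> \<int>\<^sub>\<le>\<^sub>0"
      using pos by (auto elim!: nonpos_Ints_cases')
    then have E_Suc: "E (Suc n) = (2 * real n + 2 + 2 * l) * ((real n + 2 * l) * Gamma (real n + 2 * l))"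
      using Gamma_plus1[of "real n + 2 * l"] unfolding E_def ext0_denominator by (simp add: add_ac)
    have E_n: "E n = (2 * real n + 2 * l) * Gamma (real n + 2 * l)"
      using Suc by (simp add: E_def ext0_denominator)
    have c_n: "c n * (real n + l + 1/2) = (real n + 1) * (2 * l + real n) / (2 * (real n + l))"
      using Suc pos by (simp add: c_def ext0_inner_factor divide_simps) (simp add: algebra_simps)
    have w: "gegenbauer_coef l (Suc n) =
        (real n + 1) * (real n + 2 * l) / (4 * (real n + 1 + l) * (real n + l))"
      using Suc by (simp add: add_ac)
    have "((real n + 1) * (2 * l + real n) / (2 * (real n + l)))\<^sup>2 *
          ((2 * real n + 2 * l) * Gamma (real n + 2 * l)) =
        (real n + 1) * ((2 * real n + 2 + 2 * l) * ((real n + 2 * l) * Gamma (real n + 2 * l))) *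
          ((real n + 1) * (real n + 2 * l) / (4 * (real n + 1 + l) * (real n + l)))"
      using pos by (simp add: divide_simps power2_eq_square) algebra
    then show ?thesis
      unfolding E_Suc E_n w power_mult_distrib[symmetric] c_n .
  qed
  have "gegenbauer_norm l n = 2 powr (2 * l) / fact n * (\<Prod>p<n. c p)\<^sup>2 *
      ((Gamma (real n + l + 1/2))\<^sup>2 / E n)"
  proof (induction n)
    case 0
    then show ?case by (simp add: gegenbauer_norm_def E_def ext0_denominator)
  next
    case (Suc n)
    have "real n + l + 1/2 \<notin> \<int>\<^sub>\<le>\<^sub>0"
      using l by (auto elim!: nonpos_Ints_cases')
    then have G: "Gamma (real (Suc n) + l + 1/2) = (real n + l + 1/2) * Gamma (real n + l + 1/2)"
      using Gamma_plus1[of "real n + l + 1/2"] by (simp add: add_ac)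
    have w: "gegenbauer_coef l (Suc n) = (c n)\<^sup>2 * (real n + l + 1/2)\<^sup>2 * E n / ((real n + 1) * E (Suc n))"
    proof -
      have "(real n + 1) * E (Suc n) > 0"
        using E_pos[of "Suc n"] by simp
      then show ?thesis
        unfolding ratio by (metis nonzero_mult_div_cancel_left less_irrefl)
    qed
    have "gegenbauer_norm l (Suc n) = gegenbauer_norm l n * gegenbauer_coef l (Suc n)"
      by (simp add: gegenbauer_norm_def)
    also have "\<dots> = 2 powr (2 * l) / fact n * (\<Prod>p<n. c p)\<^sup>2 * ((Gamma (real n + l + 1/2))\<^sup>2 / E n) *
        ((c n)\<^sup>2 * (real n + l + 1/2)\<^sup>2 * E n / ((real n + 1) * E (Suc n)))"
      unfolding Suc w ..
    also have "\<dots> = 2 powr (2 * l) / fact (Suc n) * (\<Prod>p<Suc n. c p)\<^sup>2 *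
        ((Gamma (real (Suc n) + l + 1/2))\<^sup>2 / E (Suc n))"
      unfolding G using E_pos[of n] E_pos[of "Suc n"]
      by (simp add: power_mult_distrib) (simp add: divide_simps)
    finally show ?case .
  qed
  then show ?thesis by (simp add: c_def E_def)
qed

end

text \<open>
  Fubini for functions of separated variables. Lebesgue measure on the vector type is the image of a
  product measure indexed by the standard basis, and the basis vectors correspond to the coordinates.
\<close>

lemma product_integral_lborel:
  fixes f :: "'d::finite \<Rightarrow> real \<Rightarrow> real"
  assumes int: "\<And>i. integrable lborel (f i)"
  shows "integrable lborel (\<lambda>x::real^'d. \<Prod>i\<in>UNIV. f i (x $ i))"
    and "(\<integral>x. (\<Prod>i\<in>UNIV. f i (x $ i)) \<partial>(lborel :: (real^'d) measure)) =
      (\<Prod>i\<in>UNIV. \<integral>t. f i t \<partial>lborel)"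
proof -
  interpret product_sigma_finite "\<lambda>_::real^'d. lborel::real measure"
    by unfold_locales
  let ?M = "\<Pi>\<^sub>M b\<in>(Basis::(real^'d) set). (lborel::real measure)"
  let ?T = "\<lambda>g. \<Sum>b\<in>(Basis::(real^'d) set). g b *\<^sub>R b"
  define idx where "idx = inv (\<lambda>i::'d. axis i (1::real))"
  have inj: "inj (\<lambda>i::'d. axis i (1::real))"
    by (rule injI) (simp add: axis_eq_axis)
  have idx: "idx (axis i 1) = i" for i
    unfolding idx_def by (rule inv_f_f[OF inj])
  have Basis: "(Basis::(real^'d) set) = range (\<lambda>i. axis i 1)"
    by (auto simp: Basis_vec_def)
  have "?T g $ i = g (axis i 1)" for g i
    using inner_sum_left_Basis[of "axis i 1" g] by (simp add: Basis cart_eq_inner_axis)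
  then have T: "(\<Prod>i\<in>UNIV. f i (?T g $ i)) = (\<Prod>b\<in>(Basis::(real^'d) set). f (idx b) (g b))" for g
    unfolding Basis by (subst prod.reindex[OF inj]) (simp add: idx)
  have meas [measurable]: "?T \<in> ?M \<rightarrow>\<^sub>M borel"
    by measurable
  have fm [measurable]: "f i \<in> borel_measurable borel" for i
    using borel_measurable_integrable[OF int[of i]] by simp
  have pm [measurable]: "(\<lambda>x::real^'d. \<Prod>i\<in>UNIV. f i (x $ i)) \<in> borel_measurable borel"
    by measurable
  show "integrable lborel (\<lambda>x::real^'d. \<Prod>i\<in>UNIV. f i (x $ i))"
    unfolding lborel_eq[where 'a = "real^'d"]
    by (subst integrable_distr_eq)
      (simp_all only: T, auto simp: int intro!: product_integrable_prod)
  show "(\<integral>x. (\<Prod>i\<in>UNIV. f i (x $ i)) \<partial>(lborel :: (real^'d) measure)) =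
      (\<Prod>i\<in>UNIV. \<integral>t. f i t \<partial>lborel)"
  proof -
    have "(\<integral>x. (\<Prod>i\<in>UNIV. f i (x $ i)) \<partial>(lborel :: (real^'d) measure)) =
        (\<integral>g. (\<Prod>b\<in>(Basis::(real^'d) set). f (idx b) (g b)) \<partial>?M)"
      unfolding lborel_eq[where 'a = "real^'d"] by (subst integral_distr) (simp_all only: T, simp_all)
    also have "\<dots> = (\<Prod>b\<in>(Basis::(real^'d) set). \<integral>t. f (idx b) t \<partial>lborel)"
      by (rule product_integral_prod) (auto simp: int)
    also have "\<dots> = (\<Prod>i\<in>UNIV. \<integral>t. f i t \<partial>lborel)"
      unfolding Basis by (subst prod.reindex[OF inj]) (simp add: idx)
    finally show ?thesis .
  qed
qed


section \<open>The product weight on the cube\<close>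

text \<open>
  The univariate polynomials, substituted into a single variable by running their recurrence in the
  multivariate polynomial ring.
\<close>

fun coordinate_gegenbauer :: "real \<Rightarrow> 'd::finite \<Rightarrow> nat \<Rightarrow> 'd cpoly" where
  "coordinate_gegenbauer l j 0 = 1"
| "coordinate_gegenbauer l j (Suc 0) = var j"
| "coordinate_gegenbauer l j (Suc (Suc k)) = var j * coordinate_gegenbauer l j (Suc k) -
     poly_scale (complex_of_real (gegenbauer_coef l (Suc k))) (coordinate_gegenbauer l j k)"

definition multi_gegenbauer :: "real ^ 'd::finite \<Rightarrow> ('d \<Rightarrow>\<^sub>0 nat) \<Rightarrow> 'd cpoly" where
  "multi_gegenbauer lam m =
     (\<Prod>j\<in>UNIV. coordinate_gegenbauer (lam $ j) j (Poly_Mapping.lookup m j))"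

lemma coordinate_gegenbauer_recurrence:
  "var j * coordinate_gegenbauer l j k = coordinate_gegenbauer l j (Suc k) +
     poly_scale (complex_of_real (gegenbauer_coef l k)) (coordinate_gegenbauer l j (k - 1))"
  by (cases k) simp_all

lemma peval_coordinate_gegenbauer:
  "peval (coordinate_gegenbauer l j k) x = complex_of_real (poly (gegenbauer_poly l k) (x $ j))"
  by (induction l j k rule: coordinate_gegenbauer.induct)
    (simp_all add: peval_1 peval_var peval_diff peval_mult peval_scale)

text \<open>
  A variable acts on the factor of its own coordinate only.
\<close>

lemma multi_gegenbauer_recurrence:
  "var j * multi_gegenbauer lam m = multi_gegenbauer lam (m + unit_exp j) +
     poly_scale (complex_of_real (gegenbauer_coef (lam $ j) (Poly_Mapping.lookup m j)))
       (multi_gegenbauer lam (m - unit_exp j))"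
proof -
  let ?c = "\<lambda>i k. coordinate_gegenbauer (lam $ i) i k" and ?l = "Poly_Mapping.lookup"
  define R where "R = (\<Prod>i\<in>UNIV - {j}. ?c i (?l m i))"
  have split: "multi_gegenbauer lam m' = ?c j (?l m' j) * R" if "\<And>i. i \<noteq> j \<Longrightarrow> ?l m' i = ?l m i" for m'
    unfolding multi_gegenbauer_def R_def
    by (subst prod.remove[of UNIV j]) (simp_all add: that)
  have 1: "multi_gegenbauer lam m = ?c j (?l m j) * R"
    by (rule split) simp
  have 2: "multi_gegenbauer lam (m + unit_exp j) = ?c j (Suc (?l m j)) * R"
    by (subst split) (simp_all add: lookup_add lookup_unit_exp)
  have 3: "multi_gegenbauer lam (m - unit_exp j) = ?c j (?l m j - 1) * R"
    by (subst split) (simp_all add: lookup_minus lookup_unit_exp)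
  show ?thesis
    unfolding 1 2 3 mult.assoc[symmetric] coordinate_gegenbauer_recurrence
    by (simp add: distrib_right poly_scale_mult_left)
qed

lemma continuous_on_peval: "continuous_on A (peval p)"
  unfolding peval_def[abs_def] by (intro continuous_intros)

definition cube_weight :: "real ^ 'd::finite \<Rightarrow> real ^ 'd \<Rightarrow> real" where
  "cube_weight lam x = (\<Prod>j\<in>UNIV. gegenbauer_weight (lam $ j) (x $ j))"

lemma cube_weight_nonneg: "cube_weight lam x \<ge> 0"
  unfolding cube_weight_def by (intro prod_nonneg) (simp add: gegenbauer_weight_nonneg)

lemma cube_weight_measurable [measurable]: "cube_weight lam \<in> borel_measurable borel"
  unfolding cube_weight_def[abs_def] by measurable

lemma gegenbauer_measure_eq:
  "gegenbauer_measure lam = density lborel (\<lambda>x. ennreal (cube_weight lam x))"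
proof -
  have "indicator {x. \<forall>j. x $ j \<in> {-1..1}} x * (\<Prod>j\<in>UNIV. (1 - (x $ j)\<^sup>2) powr (lam $ j - 1/2)) =
      cube_weight lam x" for x
  proof (cases "\<forall>j. x $ j \<in> {-1..1}")
    case True
    then show ?thesis by (simp add: cube_weight_def gegenbauer_weight_def)
  next
    case False
    then obtain j where "x $ j \<notin> {-1..1}" by blast
    then have "gegenbauer_weight (lam $ j) (x $ j) = 0"
      by (simp add: gegenbauer_weight_def)
    then have "cube_weight lam x = 0"
      unfolding cube_weight_def by (intro prod_zero) auto
    then show ?thesis using False by auto
  qed
  then show ?thesis by (simp only: gegenbauer_measure_def)
qed

lemma integrable_cube_weight:
  assumes "\<forall>i. lam $ i > - (1/2)"
  shows "integrable lborel (cube_weight lam)"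
  unfolding cube_weight_def[abs_def]
  using assms by (intro product_integral_lborel(1) integrable_gegenbauer_weight) simp

text \<open>
  The integrand is bounded on the cube, outside of which the integrable weight vanishes.
\<close>

lemma integrable_gegenbauer_measure:
  assumes lam: "\<forall>i. lam $ i > - (1/2)"
  shows "integrable (gegenbauer_measure lam) (\<lambda>x. cnj (peval p x) * peval q x)"
proof -
  let ?f = "\<lambda>x. cnj (peval p x) * peval q x"
  have cont: "continuous_on A ?f" for A
    by (intro continuous_intros continuous_on_peval)
  have [measurable]: "?f \<in> borel_measurable borel"
    by (rule borel_measurable_continuous_onI[OF cont])
  have "bounded (?f ` cbox (vec (-1)) (vec 1))"
    by (intro compact_imp_bounded compact_continuous_image cont compact_cbox)
  then have "\<exists>C. \<forall>x\<in>cbox (vec (-1)) (vec 1). norm (?f x) \<le> C"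
    by (auto simp: bounded_iff)
  then obtain C where C: "\<And>x. x \<in> cbox (vec (-1)) (vec 1) \<Longrightarrow> norm (?f x) \<le> C"
    by blast
  have "integrable lborel (\<lambda>x. cube_weight lam x *\<^sub>R ?f x)"
  proof (rule Bochner_Integration.integrable_bound[of _ "\<lambda>x. C * cube_weight lam x"])
    show "AE x in lborel. norm (cube_weight lam x *\<^sub>R ?f x) \<le> norm (C * cube_weight lam x)"
    proof (intro AE_I2)
      fix x :: "real ^ 'a"
      show "norm (cube_weight lam x *\<^sub>R ?f x) \<le> norm (C * cube_weight lam x)"
      proof (cases "x \<in> cbox (vec (-1)) (vec 1)")
        case True
        then show ?thesis
          using mult_right_mono[OF order_trans[OF C[OF True] abs_ge_self] cube_weight_nonneg[of lam x]]
          by (simp add: abs_mult norm_mult cube_weight_nonneg mult.commute)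
      next
        case False
        then obtain j where "x $ j \<notin> {-1..1}"
          by (auto simp: mem_box_cart)
        then have "gegenbauer_weight (lam $ j) (x $ j) = 0"
          by (simp add: gegenbauer_weight_def)
        then have "cube_weight lam x = 0"
          unfolding cube_weight_def by (intro prod_zero) auto
        then show ?thesis by simp
      qed
    qed
  qed (auto intro: integrable_cube_weight[OF lam])
  then show ?thesis
    unfolding gegenbauer_measure_eq
    by (subst integrable_density) (auto simp: cube_weight_nonneg)
qed

definition multi_gegenbauer_norm :: "real ^ 'd::finite \<Rightarrow> ('d \<Rightarrow>\<^sub>0 nat) \<Rightarrow> real" where
  "multi_gegenbauer_norm lam m = (\<Prod>j\<in>UNIV. gegenbauer_norm (lam $ j) (Poly_Mapping.lookup m j))"

text \<open>
  Weight and polynomials are products over the coordinates, so the integral is a product of integrals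
  over the interval, one of which vanishes as soon as the indices differ somewhere.
\<close>

lemma pip_multi_gegenbauer:
  fixes lam :: "real ^ 'd::finite"
  assumes lam: "\<forall>i. lam $ i > - (1/2)"
  shows "pip (gegenbauer_measure lam) (multi_gegenbauer lam m) (multi_gegenbauer lam m') =
    (if m = m' then complex_of_real (multi_gegenbauer_norm lam m) else 0)"
proof -
  let ?p = "\<lambda>j k. gegenbauer_poly (lam $ j) (Poly_Mapping.lookup k j)"
  let ?f = "\<lambda>j t. gegenbauer_weight (lam $ j) t * poly (?p j m * ?p j m') t"
  have ev: "cube_weight lam x *\<^sub>R (cnj (peval (multi_gegenbauer lam m) x) * peval (multi_gegenbauer lam m') x) =
      complex_of_real (\<Prod>j\<in>UNIV. ?f j (x $ j))" for x
    by (simp add: multi_gegenbauer_def peval_prod peval_coordinate_gegenbauer cube_weight_def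
        prod.distrib scaleR_conv_of_real mult_ac)
  have int: "integrable lborel (?f j)" for j
    using lam by (intro integrable_gegenbauer_weight_poly) simp
  have int_prod: "(\<integral>x. (\<Prod>j\<in>UNIV. ?f j (x $ j)) \<partial>(lborel :: (real ^ 'd) measure)) =
      (\<Prod>j\<in>UNIV. gegenbauer_integral (lam $ j) (?p j m * ?p j m'))"
    unfolding gegenbauer_integral_def by (rule product_integral_lborel(2)[of ?f, OF int])
  have factors: "gegenbauer_integral (lam $ j) (?p j m * ?p j m') =
      (if Poly_Mapping.lookup m j = Poly_Mapping.lookup m' j
       then gegenbauer_norm (lam $ j) (Poly_Mapping.lookup m j) else 0)" for j
    by (rule gegenbauer_orthogonality[OF lam[rule_format]])
  have prod_norms: "(\<Prod>j\<in>UNIV. if Poly_Mapping.lookup m j = Poly_Mapping.lookup m' j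
        then gegenbauer_norm (lam $ j) (Poly_Mapping.lookup m j) else 0) =
      (if m = m' then multi_gegenbauer_norm lam m else 0)"
  proof (cases "m = m'")
    case True
    then show ?thesis by (simp add: multi_gegenbauer_norm_def)
  next
    case False
    then obtain j where "Poly_Mapping.lookup m j \<noteq> Poly_Mapping.lookup m' j"
      using poly_mapping_eqI[of m m'] by metis
    then have "(\<Prod>j\<in>UNIV. if Poly_Mapping.lookup m j = Poly_Mapping.lookup m' j
        then gegenbauer_norm (lam $ j) (Poly_Mapping.lookup m j) else 0) = 0"
      by (intro prod_zero bexI[of _ j]) simp_all
    then show ?thesis using False by simp
  qed
  have meas: "(\<lambda>x. cnj (peval (multi_gegenbauer lam m) x) * peval (multi_gegenbauer lam m') x)
      \<in> borel_measurable borel"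
    by (intro borel_measurable_continuous_onI continuous_intros continuous_on_peval)
  have "pip (gegenbauer_measure lam) (multi_gegenbauer lam m) (multi_gegenbauer lam m') =
      (\<integral>x. cube_weight lam x *\<^sub>R
        (cnj (peval (multi_gegenbauer lam m) x) * peval (multi_gegenbauer lam m') x) \<partial>lborel)"
    unfolding pip_def gegenbauer_measure_eq
    by (rule integral_density) (use meas in \<open>simp_all add: cube_weight_nonneg\<close>)
  also have "\<dots> = (\<integral>x. complex_of_real (\<Prod>j\<in>UNIV. ?f j (x $ j)) \<partial>lborel)"
    by (simp only: ev)
  also have "\<dots> = complex_of_real (\<integral>x. (\<Prod>j\<in>UNIV. ?f j (x $ j)) \<partial>lborel)"
    by (rule integral_complex_of_real)
  also have "\<dots> = complex_of_real (if m = m' then multi_gegenbauer_norm lam m else 0)"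
    unfolding int_prod factors prod_norms ..
  finally show ?thesis
    by (simp only: if_distrib of_real_0)
qed

lemma orthogonal_family_multi_gegenbauer:
  assumes lam: "\<forall>i. lam $ i > - (1/2)"
  shows "orthogonal_family (gegenbauer_measure lam) (multi_gegenbauer lam)
    (\<lambda>j m. complex_of_real (gegenbauer_coef (lam $ j) (Poly_Mapping.lookup m j)))
    (multi_gegenbauer_norm lam)"
proof (rule orthogonal_family.intro, goal_cases)
  case (1 p q)
  show ?case by (rule integrable_gegenbauer_measure[OF lam])
next
  case 2
  show ?case by (simp add: multi_gegenbauer_def)
next
  case (3 j m)
  show ?case by (rule multi_gegenbauer_recurrence)
next
  case (4 m j)
  then show ?case by simp
next
  case (5 m m')
  show ?case by (rule pip_multi_gegenbauer[OF lam])
next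
  case (6 m)
  show ?case
    unfolding multi_gegenbauer_norm_def using lam by (intro prod_pos) (simp add: gegenbauer_norm_pos)
qed

theorem theorem6p3:
  fixes lam :: "real ^ 'd::finite"
  assumes "\<forall>i. lam $ i > - (1/2)"
  shows "(\<forall>n v. \<forall>T\<in>sym_tensors n. Jacobi_alpha (gegenbauer_measure lam) v n T = 0) \<and>
    (\<forall>n. \<forall>i j :: 'd list. length i = n \<and> length j = n \<longrightarrow>
       (let N = (\<lambda>l. count_list i l) in
        Omega_coeff (gegenbauer_measure lam) n (tuple_class n i) (tuple_class n j) =
        complex_of_real
         (of_bool (tuple_class n i = tuple_class n j) *
          (2 powr (2 * (\<Sum>l\<in>UNIV. lam $ l)) / (\<Prod>l\<in>UNIV. fact (N l))) *
          (\<Prod>l\<in>UNIV. (\<Prod>p<N l.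
             ext0 (\<lambda>t. (real p + 1) * (2 * t + real p) /
                       ((real p + t) * (2 * real p + 2 * t + 1))) (lam $ l))\<^sup>2) *
          (\<Prod>l\<in>UNIV. (Gamma (real (N l) + lam $ l + 1/2))\<^sup>2 /
             ext0 (\<lambda>t. (2 * real (N l) + 2 * t) * Gamma (real (N l) + 2 * t)) (lam $ l)))))"
proof -
  interpret orthogonal_family "gegenbauer_measure lam" "multi_gegenbauer lam"
    "\<lambda>j m. complex_of_real (gegenbauer_coef (lam $ j) (Poly_Mapping.lookup m j))"
    "multi_gegenbauer_norm lam"
    using assms by (rule orthogonal_family_multi_gegenbauer)
  have norm: "multi_gegenbauer_norm lam (exponent i) =
      2 powr (2 * (\<Sum>l\<in>UNIV. lam $ l)) / (\<Prod>l\<in>UNIV. fact (count_list i l)) *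
      (\<Prod>l\<in>UNIV. (\<Prod>p<count_list i l.
         ext0 (\<lambda>t. (real p + 1) * (2 * t + real p) /
                   ((real p + t) * (2 * real p + 2 * t + 1))) (lam $ l))\<^sup>2) *
      (\<Prod>l\<in>UNIV. (Gamma (real (count_list i l) + lam $ l + 1/2))\<^sup>2 /
         ext0 (\<lambda>t. (2 * real (count_list i l) + 2 * t) * Gamma (real (count_list i l) + 2 * t))
           (lam $ l))" for i :: "'d list"
  proof -
    have "multi_gegenbauer_norm lam (exponent i) = (\<Prod>l\<in>UNIV.
        2 powr (2 * lam $ l) / fact (count_list i l) *
        (\<Prod>p<count_list i l.
           ext0 (\<lambda>t. (real p + 1) * (2 * t + real p) /
                     ((real p + t) * (2 * real p + 2 * t + 1))) (lam $ l))\<^sup>2 *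
        ((Gamma (real (count_list i l) + lam $ l + 1/2))\<^sup>2 /
           ext0 (\<lambda>t. (2 * real (count_list i l) + 2 * t) * Gamma (real (count_list i l) + 2 * t))
             (lam $ l)))"
      unfolding multi_gegenbauer_norm_def lookup_exponent
      using assms by (intro prod.cong refl gegenbauer_norm_closed_form) blast
    moreover have "2 powr (2 * (\<Sum>l\<in>UNIV. lam $ l)) = (\<Prod>l\<in>UNIV. 2 powr (2 * lam $ l))"
      unfolding sum_distrib_left by (rule powr_sum) simp_all
    ultimately show ?thesis
      by (simp only: prod.distrib prod_dividef)
  qed
  show ?thesis
  proof (intro conjI allI ballI impI, goal_cases)
    case (1 n v T)
    then show ?case by (rule Jacobi_alpha_eq_0)
  next
    case (2 n i j)
    then have "length i = n" "length j = n" by auto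
    then show ?case
      unfolding Let_def by (subst Omega_coeff_eq) (simp_all only: norm mult.assoc)
  qed
qed

end
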